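(* Let $n \geq 3$, let $\vec{q}=(q_1,\dots,q_n) \in \mathbb{Q}^n$ have distinct non-zero entries, and let $\vec\alpha\in\mathbb{R}^n$ be given by $\alpha_j=q_j^{-1}$ for $1\le j\le n$. Then the operator defined a priori on $\mathcal{S}(\mathbb{R})^n$ by $$ (\vec{f})\mapsto \sup_{M \in \mathbb{R}} \left| \int_{\{\vec{\xi}\in\mathbb{R}^n:\ \vec{\xi} \cdot \vec{\alpha} >0,\ \xi_n < M\}} \left[ \prod_{j=1}^n \hat{f}_j(\xi_j) e^{2 \pi i x \xi_j }\right] d\xi_1 \cdots d\xi_n \right| $$ satisfies no $L^p$ estimates.
   Context: $\mathcal{S}(\mathbb{R})$ is the Schwartz class on $\mathbb{R}$ and $\hat f(\xi)=\int_{\mathbb{R}} f(x)e^{-2\pi i x\xi}\,dx$. An $n$-(sub)linear operator $T$ defined a priori on $\mathcal{S}(\mathbb{R})^n$ "satisfies no $L^p$ estimates" if there does not exist any $n$-tuple $(p_1,\dots,p_n)\in[1,\infty]^n$ for which there is a constant $C$ such that $\|T(\vec f)\|_{p} \le C\prod_{j=1}^n \|f_j\|_{p_j}$ for all $\vec f=(f_1,\dots,f_n)\in\mathcal{S}(\mathbb{R})^n$, where $\frac1p=\sum_{j=1}^n\frac1{p_j}$ (with $1/\infty=0$). *)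

theory Defs
  imports "HOL-Analysis.Analysis" "HOL-Probability.Essential_Supremum"
begin

abbreviation higher_vector_derivative :: "nat \<Rightarrow> (real \<Rightarrow> complex) \<Rightarrow> real \<Rightarrow> complex" where
  "higher_vector_derivative k f \<equiv> ((\<lambda>g x. vector_derivative g (at x)) ^^ k) f"

definition schwartz :: "(real \<Rightarrow> complex) \<Rightarrow> bool" where
  "schwartz f \<longleftrightarrow>
     (\<forall>k x. higher_vector_derivative k f differentiable (at x)) \<and>
     (\<forall>k m. \<exists>B. \<forall>x. \<bar>x\<bar> ^ m * norm (higher_vector_derivative k f x) \<le> B)"

definition fourier :: "(real \<Rightarrow> complex) \<Rightarrow> real \<Rightarrow> complex" where
  "fourier f \<xi> = (LINT x|lborel. f x * exp (- 2 * pi * \<i> * x * \<xi>))"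

text \<open>Powers and \<open>L\<^sup>p\<close> (quasi-)norms of functions with values in \<open>[0,\<infinity>]\<close>, meant for exponents
  \<open>p > 0\<close> only; \<open>p = \<infinity>\<close> is allowed for the norm, and \<open>0 < p < 1\<close> does occur.\<close>

definition ennreal_powr :: "ennreal \<Rightarrow> real \<Rightarrow> ennreal" where
  "ennreal_powr y p = (if y = \<infinity> then \<infinity> else ennreal (enn2real y powr p))"

definition Lp_norm :: "ennreal \<Rightarrow> (real \<Rightarrow> ennreal) \<Rightarrow> ennreal" where
  "Lp_norm p g =
     (if p = \<infinity> then esssup lborel g
      else ennreal_powr (\<integral>\<^sup>+ x. ennreal_powr (g x) (enn2real p) \<partial>lborel) (1 / enn2real p))"

text \<open>A tuple \<open>(f\<^sub>1, \<dots>, f\<^sub>n)\<close> is a function on \<open>nat\<close> of which only the values on \<open>{1..n}\<close> matter, and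
  \<open>T f x\<close> stands for the absolute value of the operator applied to \<open>f\<close> at \<open>x\<close>. On type \<open>ennreal\<close>,
  \<open>inverse \<infinity> = 0\<close> and \<open>inverse 0 = \<infinity>\<close>, so the target exponent is \<open>\<infinity>\<close> iff all \<open>p j\<close> are.\<close>

definition satisfies_no_Lp_estimates ::
    "nat \<Rightarrow> ((nat \<Rightarrow> real \<Rightarrow> complex) \<Rightarrow> real \<Rightarrow> ennreal) \<Rightarrow> bool" where
  "satisfies_no_Lp_estimates n T \<longleftrightarrow>
     \<not> (\<exists>p :: nat \<Rightarrow> ennreal. (\<forall>j\<in>{1..n}. 1 \<le> p j) \<and>
          (\<exists>C::ennreal. C < \<infinity> \<and>
             (\<forall>f. (\<forall>j\<in>{1..n}. schwartz (f j)) \<longrightarrow>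
                Lp_norm (inverse (\<Sum>j\<in>{1..n}. inverse (p j))) (T f)
                  \<le> C * (\<Prod>j\<in>{1..n}. Lp_norm (p j) (\<lambda>x. ennreal (norm (f j x)))))))"

text \<open>Points of \<open>\<real>\<^sup>n\<close> are the elements of the space of the product measure over the index set \<open>{1..n}\<close>.
  The supremum is taken in \<open>[0,\<infinity>]\<close>, so that it needs no boundedness proviso.\<close>

definition maximal_multiplier_op ::
    "nat \<Rightarrow> (nat \<Rightarrow> real) \<Rightarrow> (nat \<Rightarrow> real \<Rightarrow> complex) \<Rightarrow> real \<Rightarrow> ennreal" where
  "maximal_multiplier_op n \<alpha> f x =
     (SUP M::real. ennreal (norm
        (LINT \<xi> : {\<xi> \<in> space (\<Pi>\<^sub>M j\<in>{1..n}. lborel). (\<Sum>j\<in>{1..n}. \<xi> j * \<alpha> j) > 0 \<and> \<xi> n < M}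
              | (\<Pi>\<^sub>M j\<in>{1..n}. lborel).
           (\<Prod>j\<in>{1..n}. fourier (f j) (\<xi> j) * exp (2 * pi * \<i> * x * \<xi> j)))))"

end

theory Submission
  imports Defs "HOL-Probability.Probability" "HOL-Real_Asymp.Real_Asymp"
begin

text \<open>Choose rates \<open>c j\<close> with \<open>c n = 1\<close> such that the sums of \<open>\<alpha> j * c j\<close> and of \<open>(\<alpha> j)\<^sup>2 * c j\<close> vanish, and test
  the operator on the Gaussian chirps \<open>exp (- \<pi> (1 - \<i> l c j) t\<^sup>2)\<close>, whose absolute values do not depend
  on \<open>l\<close>. The product of the \<open>f j (x - \<alpha> j * t)\<close> then does not oscillate in \<open>t\<close>, and the cut-off
  \<open>\<xi> n < M\<close> with \<open>M = l * x\<close> restricts the kernel \<open>1 / t\<close> to one side of \<open>0\<close>, so that the operator is of size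
  \<open>ln l\<close> for all \<open>x\<close> in a fixed neighbourhood of \<open>0\<close>.

  On the Fourier side everything is Gaussian: the multiplier integral only depends on the joint
  distribution of the sum of \<open>\<alpha> j * \<xi> j\<close> over \<open>j < n\<close> and of \<open>\<xi> n\<close>, a product of two complex Gaussians, and it
  reduces to an integral over a planar wedge, which is computed in polar-like coordinates.\<close>

section \<open>Gaussians with complex parameters\<close>

text \<open>The phase of the product of the \<open>f j (x - \<alpha> j * t)\<close> is quadratic in
  \<open>t\<close>: the first condition on the rates removes its term in \<open>x * t\<close>, the
  second the one in \<open>t ^ 2\<close>. \<open>M = l * x\<close> is the instantaneous frequency of
  \<open>f n\<close> at \<open>x\<close>; since \<open>f n (x - \<alpha> n * t)\<close> has
  frequency \<open>l * (x - \<alpha> n * t)\<close> there, the cut-off decides the sign of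
  \<open>t\<close> and the odd kernel no longer cancels. On the Fourier side the first condition
  puts the real parts of the centres on the hyperplane where the sum of the
  \<open>\<alpha> j * \<xi> j\<close> vanishes; the second makes the oscillation die out along that
  edge of the wedge, which leaves an integral of the size of that of \<open>1 / (1 + l * t)\<close>
  over an interval ending at \<open>0\<close>. As the moduli do not see \<open>l\<close>, one family
  defeats all exponents, and a lower bound on a fixed interval also serves target exponents below 1.
  The obstacle is that the variances are complex. Contour shifts and branches of square roots are
  avoided: Gaussian integrals come from differential equations in their parameters, and only the
  moduli of constants are followed to the end.\<close>

definition gexp :: "complex \<Rightarrow> complex \<Rightarrow> real \<Rightarrow> complex" where
  "gexp a b x = exp (- (of_real pi * a * (of_real x)\<^sup>2) + 2 * of_real pi * b * of_real x)"

lemma norm_gexp: "norm (gexp a b x) = exp (- (pi * Re a * x\<^sup>2) + 2 * pi * Re b * x)"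
  by (simp add: gexp_def norm_exp_eq_Re power2_eq_square)

lemma gexp_0 [simp]: "gexp a b 0 = 1"
  by (simp add: gexp_def)

lemma isCont_gexp: "isCont (gexp a b) x"
  unfolding gexp_def by (intro continuous_intros)

lemma measurable_gexp [measurable]:
  assumes [measurable]: "a \<in> borel_measurable M" "b \<in> borel_measurable M" "f \<in> borel_measurable M"
  shows "(\<lambda>x. gexp (a x) (b x) (f x)) \<in> borel_measurable M"
  unfolding gexp_def by measurable

lemma integrable_exp_neg_square:
  fixes c :: real
  assumes "c > 0"
  shows "integrable lborel (\<lambda>x::real. exp (- (c * x\<^sup>2)))"
    and "(LINT x|lborel. exp (- (c * x\<^sup>2))) = sqrt (pi / c)"
proof -
  have g: "has_bochner_integral lborel (\<lambda>x::real. exp (- x\<^sup>2)) (sqrt pi)"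
    using has_bochner_integral_even_function[OF gaussian_moment_0] by simp
  have i: "integrable lborel (\<lambda>x::real. exp (- x\<^sup>2))"
    using g by (rule integrable.intros)
  have eq: "(\<lambda>x::real. exp (- (c * x\<^sup>2))) = (\<lambda>x. exp (- (0 + sqrt c * x)\<^sup>2))"
    using assms by (simp add: power_mult_distrib)
  show "integrable lborel (\<lambda>x::real. exp (- (c * x\<^sup>2)))"
    unfolding eq by (rule lborel_integrable_real_affine[OF i]) (use assms in auto)
  have "sqrt pi = sqrt c * (LINT x|lborel. exp (- (c * x\<^sup>2)))"
    using lborel_integral_real_affine[of "sqrt c" "\<lambda>x::real. exp (- x\<^sup>2)" 0] assms
      has_bochner_integral_integral_eq[OF g] by (simp add: power_mult_distrib)
  then show "(LINT x|lborel. exp (- (c * x\<^sup>2))) = sqrt (pi / c)"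
    using assms by (simp add: real_sqrt_divide field_simps)
qed

lemma linear_le_quadratic:
  fixes c B x :: real
  assumes "c > 0"
  shows "B * \<bar>x\<bar> \<le> c * x\<^sup>2 + B\<^sup>2 / (4 * c)"
proof -
  have "0 \<le> (2 * c * \<bar>x\<bar> - B)\<^sup>2 / (4 * c)"
    using assms by simp
  also have "\<dots> = c * x\<^sup>2 - B * \<bar>x\<bar> + B\<^sup>2 / (4 * c)"
    using assms by (simp add: power2_eq_square field_simps)
  finally show ?thesis by simp
qed

text \<open>Half of the quadratic decay is spent on absorbing the linear terms, by completing the
  square; the other half is kept.\<close>

lemma gexp_bound:
  assumes "Re a > 0"
  shows "exp (B * \<bar>x\<bar>) * norm (gexp a b x)
    \<le> exp ((B + 2 * pi * \<bar>Re b\<bar>)\<^sup>2 / (2 * pi * Re a)) * exp (- (pi * Re a / 2 * x\<^sup>2))"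
proof -
  have "2 * pi * Re b * x \<le> 2 * pi * \<bar>Re b\<bar> * \<bar>x\<bar>"
    by (metis abs_ge_self abs_mult abs_numeral abs_of_nonneg mult.assoc pi_ge_zero)
  then have "B * \<bar>x\<bar> + (- (pi * Re a * x\<^sup>2) + 2 * pi * Re b * x) \<le>
     (B + 2 * pi * \<bar>Re b\<bar>) * \<bar>x\<bar> - pi * Re a * x\<^sup>2"
    by (simp add: algebra_simps)
  also have "\<dots> \<le> (B + 2 * pi * \<bar>Re b\<bar>)\<^sup>2 / (2 * pi * Re a) + - (pi * Re a / 2 * x\<^sup>2)"
    using linear_le_quadratic[of "pi * Re a / 2" "B + 2 * pi * \<bar>Re b\<bar>" x] assms
    by (simp add: algebra_simps)
  finally show ?thesis
    by (simp add: norm_gexp exp_add [symmetric])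
qed

lemma power_le_fact_exp: "\<bar>x\<bar> ^ k \<le> fact k * exp \<bar>x::real\<bar>"
proof -
  have "\<bar>x\<bar> ^ k / fact k = (\<Sum>n\<in>{k}. \<bar>x\<bar> ^ n /\<^sub>R fact n)"
    by (simp add: divide_inverse)
  also have "\<dots> \<le> (\<Sum>n. \<bar>x\<bar> ^ n /\<^sub>R fact n)"
    by (intro sum_le_suminf summable_exp_generic) auto
  also have "\<dots> = exp \<bar>x\<bar>"
    by (simp add: exp_def)
  finally show ?thesis by (simp add: field_simps)
qed

text \<open>The power is absorbed into one more factor \<open>exp \<bar>x\<bar>\<close>, hence
  \<open>B + 1\<close> in the constant. The factor \<open>exp (B * \<bar>x\<bar>)\<close> serves the
  differentiation in \<open>b\<close>, whose majorant grows exponentially.\<close>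

lemma power_gexp_bound:
  assumes "Re a > 0" "B \<ge> 0"
  obtains C where "C > 0" "\<And>x. \<bar>x\<bar> ^ k * exp (B * \<bar>x\<bar>) * norm (gexp a b x) \<le> C * exp (- (pi * Re a / 2 * x\<^sup>2))"
proof
  let ?C = "fact k * exp ((B + 1 + 2 * pi * \<bar>Re b\<bar>)\<^sup>2 / (2 * pi * Re a))"
  show "?C > 0" by simp
  fix x
  have "\<bar>x\<bar> ^ k * exp (B * \<bar>x\<bar>) * norm (gexp a b x)
      \<le> fact k * exp \<bar>x\<bar> * exp (B * \<bar>x\<bar>) * norm (gexp a b x)"
    by (intro mult_right_mono power_le_fact_exp) auto
  also have "\<dots> = fact k * (exp ((B + 1) * \<bar>x\<bar>) * norm (gexp a b x))"
    by (simp add: exp_add[symmetric] algebra_simps)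
  also have "\<dots> \<le> fact k * (exp ((B + 1 + 2 * pi * \<bar>Re b\<bar>)\<^sup>2 / (2 * pi * Re a)) * exp (- (pi * Re a / 2 * x\<^sup>2)))"
    by (intro mult_left_mono gexp_bound assms) auto
  finally show "\<bar>x\<bar> ^ k * exp (B * \<bar>x\<bar>) * norm (gexp a b x) \<le> ?C * exp (- (pi * Re a / 2 * x\<^sup>2))"
    by (simp add: mult.assoc)
qed

lemma integrable_power_gexp:
  assumes "Re a > 0"
  shows "integrable lborel (\<lambda>x. of_real x ^ k * gexp a b x)"
proof -
  obtain C where C: "C > 0" "\<And>x. \<bar>x\<bar> ^ k * exp (0 * \<bar>x\<bar>) * norm (gexp a b x) \<le> C * exp (- (pi * Re a / 2 * x\<^sup>2))"
    using power_gexp_bound[OF assms order_refl] by metis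
  show ?thesis
  proof (rule Bochner_Integration.integrable_bound)
    show "integrable lborel (\<lambda>x. C * exp (- (pi * Re a / 2 * x\<^sup>2)))"
      using assms by (intro integrable_mult_right integrable_exp_neg_square) auto
    show "AE x in lborel. norm (of_real x ^ k * gexp a b x) \<le> norm (C * exp (- (pi * Re a / 2 * x\<^sup>2)))"
      using C by (auto simp: norm_mult norm_power)
  qed measurable
qed

lemma integrable_gexp: "Re a > 0 \<Longrightarrow> integrable lborel (gexp a b)"
  using integrable_power_gexp[of a 0 b] by simp

lemma power_gexp_tendsto_0:
  assumes "Re a > 0" and F: "F = at_top \<or> F = at_bot"
  shows "((\<lambda>x. of_real x ^ k * gexp a b x) \<longlongrightarrow> 0) F"
proof -
  obtain C where C: "C > 0" "\<And>x. \<bar>x\<bar> ^ k * exp (0 * \<bar>x\<bar>) * norm (gexp a b x) \<le> C * exp (- (pi * Re a / 2 * x\<^sup>2))"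
    using power_gexp_bound[OF assms(1) order_refl] by metis
  have *: "((\<lambda>x::real. C * exp (- (c * x\<^sup>2))) \<longlongrightarrow> 0) F" if "c > 0" for c
    using F that \<open>C > 0\<close> by (elim disjE; hypsubst) real_asymp+
  show ?thesis
    by (rule Lim_null_comparison[OF _ *[of "pi * Re a / 2"]])
      (use C assms in \<open>auto simp: norm_mult norm_power\<close>)
qed

lemma gexp_has_vector_derivative:
  "(gexp a b has_vector_derivative (- 2 * of_real pi * a * of_real x + 2 * of_real pi * b) * gexp a b x) (at x within S)"
proof -
  have "((\<lambda>w. - (of_real pi * a * w\<^sup>2) + 2 * of_real pi * b * w) has_field_derivative
      - 2 * of_real pi * a * of_real x + 2 * of_real pi * b) (at (of_real x))"
    by (auto intro!: derivative_eq_intros)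
  from DERIV_fun_exp[OF this]
  have "((\<lambda>w. exp (- (of_real pi * a * w\<^sup>2) + 2 * of_real pi * b * w)) has_field_derivative
      (- 2 * of_real pi * a * of_real x + 2 * of_real pi * b) * gexp a b x) (at (of_real x))"
    unfolding gexp_def by (subst mult.commute) assumption
  then show ?thesis
    unfolding gexp_def[abs_def]
    by (rule has_vector_derivative_at_within[OF has_vector_derivative_real_field])
qed

section \<open>Improper integrals and differentiation under the integral sign\<close>

lemma integral_FTC_real_line:
  fixes f F :: "real \<Rightarrow> complex"
  assumes "\<And>x. (F has_vector_derivative f x) (at x)" "\<And>x. isCont f x" "integrable lborel f"
    and "(F \<longlongrightarrow> A) at_bot" "(F \<longlongrightarrow> B) at_top"
  shows "(LINT x|lborel. f x) = B - A"
proof -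
  have "(LBINT x=-\<infinity>..\<infinity>. f x) = B - A"
    by (rule interval_integral_FTC_integrable)
      (use assms in \<open>auto simp: set_integrable_def ereal_tendsto_simps\<close>)
  then show ?thesis
    by (simp add: interval_integral_to_infinity_eq interval_lebesgue_integral_def set_lebesgue_integral_def einterval_def)
qed

lemma integral_FTC_half_line:
  fixes f F :: "real \<Rightarrow> complex"
  assumes "\<And>x. (F has_vector_derivative f x) (at x)" "\<And>x. isCont f x" "integrable lborel f"
    and "(F \<longlongrightarrow> B) at_top"
  shows "(LINT x:{0<..}|lborel. f x) = B - F 0"
proof -
  have "(F \<longlongrightarrow> F 0) (at_right 0)"
    using has_vector_derivative_continuous[OF assms(1)[of 0]]
    by (simp add: continuous_at filterlim_at_split isCont_def)
  then have "(LBINT x=ereal 0..\<infinity>. f x) = B - F 0"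
    by (intro interval_integral_FTC_integrable)
      (use assms in \<open>auto simp: set_integrable_def ereal_tendsto_simps intro!: integrable_mult_indicator\<close>)
  then show ?thesis
    by (simp add: interval_integral_to_infinity_eq)
qed

text \<open>The second-order Taylor remainder of \<open>exp (h * p x)\<close> shows that the
  difference quotient misses the candidate derivative by at most \<open>norm h\<close> times one
  fixed integral, the one in the last assumption. The cases needed are \<open>p\<close> linear
  (variation of \<open>b\<close>) and \<open>p\<close> quadratic (variation of
  \<open>a\<close>).\<close>

lemma integral_exp_has_field_derivative:
  fixes f p :: "real \<Rightarrow> complex"
  assumes r: "r > 0"
    and [measurable]: "f \<in> borel_measurable M" "p \<in> borel_measurable M"
    and i0: "\<And>h. norm h < r \<Longrightarrow> integrable M (\<lambda>x. f x * exp (h * p x))"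
    and i1: "integrable M (\<lambda>x. f x * p x)"
    and i2: "integrable M (\<lambda>x. norm (f x) * (norm (p x))\<^sup>2 * exp (r * norm (p x)))"
  shows "((\<lambda>h. LINT x|M. f x * exp (h * p x)) has_field_derivative (LINT x|M. f x * p x)) (at 0)"
proof -
  let ?D = "LINT x|M. f x * p x"
  let ?K = "LINT x|M. norm (f x) * (norm (p x))\<^sup>2 * exp (r * norm (p x))"
  let ?F = "\<lambda>h. LINT x|M. f x * exp (h * p x)"
  have bound: "norm ((?F h - ?F 0) / h - ?D) \<le> norm h * ?K" if h: "h \<noteq> 0" "norm h < r" for h
  proof -
    have i: "integrable M (\<lambda>x. f x * exp (h * p x) - f x * exp (0 * p x) - h * (f x * p x))"
      using i0[of h] i0[of 0] i1 h r by (intro Bochner_Integration.integrable_diff integrable_mult_right) auto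
    have "(?F h - ?F 0) - h * ?D = (LINT x|M. f x * exp (h * p x) - f x * exp (0 * p x) - h * (f x * p x))"
      using i0[of h] i0[of 0] i1 h r by simp
    also have "norm \<dots> \<le> (LINT x|M. (norm h)\<^sup>2 * (norm (f x) * (norm (p x))\<^sup>2 * exp (r * norm (p x))))"
    proof (rule Bochner_Integration.integral_norm_bound_integral[OF i])
      show "integrable M (\<lambda>x. (norm h)\<^sup>2 * (norm (f x) * (norm (p x))\<^sup>2 * exp (r * norm (p x))))"
        using i2 by simp
      fix x
      have "norm (exp (h * p x) - 1 - h * p x) \<le> exp (norm (h * p x)) * (norm (h * p x))\<^sup>2"
        using Taylor_exp_field[of "h * p x" 1] by (simp add: power2_eq_square diff_diff_add)
      also have "\<dots> \<le> exp (r * norm (p x)) * (norm (h * p x))\<^sup>2"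
        using h by (intro mult_right_mono) (auto simp: norm_mult intro!: mult_right_mono)
      finally have "norm (f x) * norm (exp (h * p x) - 1 - h * p x)
          \<le> norm (f x) * (exp (r * norm (p x)) * (norm (h * p x))\<^sup>2)"
        by (rule mult_left_mono) auto
      then show "norm (f x * exp (h * p x) - f x * exp (0 * p x) - h * (f x * p x))
          \<le> (norm h)\<^sup>2 * (norm (f x) * (norm (p x))\<^sup>2 * exp (r * norm (p x)))"
        by (simp add: norm_mult[symmetric] algebra_simps) (simp add: norm_mult power_mult_distrib algebra_simps)
    qed
    finally have "norm ((?F h - ?F 0) - h * ?D) \<le> (norm h)\<^sup>2 * ?K"
      by simp
    moreover have "(?F h - ?F 0) / h - ?D = ((?F h - ?F 0) - h * ?D) / h"
      using h by (simp add: field_simps)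
    ultimately show ?thesis
      using h by (simp add: norm_divide power2_eq_square field_simps)
  qed
  have "((\<lambda>h. norm h * ?K) \<longlongrightarrow> 0) (at (0::complex))"
    by (auto intro!: tendsto_eq_intros)
  moreover have "\<forall>\<^sub>F h in at 0. norm ((?F h - ?F 0) / h - ?D) \<le> norm h * ?K"
    unfolding eventually_at using r bound by (intro exI[of _ r]) auto
  ultimately have "((\<lambda>h. (?F h - ?F 0) / h - ?D) \<longlongrightarrow> 0) (at 0)"
    by (rule Lim_null_comparison[rotated])
  then show ?thesis
    unfolding has_field_derivative_iff diff_0_right by (rule LIM_zero_cancel)
qed

section \<open>Evaluation of the complex Gaussian integral\<close>

definition gint :: "complex \<Rightarrow> complex \<Rightarrow> complex" where
  "gint a b = (LINT x|lborel. gexp a b x)"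

lemma gexp_add: "gexp (a + a') (b + b') x = gexp a b x * gexp a' b' x"
  by (simp add: gexp_def exp_add[symmetric] algebra_simps)

text \<open>The derivative of \<open>gexp a b\<close> integrates to 0, since \<open>gexp a b\<close>
  vanishes at both ends of the line.\<close>

lemma gint_moment_1:
  assumes "Re a > 0"
  shows "a * (LINT x|lborel. of_real x * gexp a b x) = b * gint a b"
proof -
  have i: "integrable lborel (gexp a b)" "integrable lborel (\<lambda>x. of_real x * gexp a b x)"
    using integrable_gexp[OF assms] integrable_power_gexp[OF assms, of 1] by auto
  have eq: "(- 2 * of_real pi * a * of_real x + 2 * of_real pi * b) * gexp a b x =
     (- 2 * of_real pi * a) * (of_real x * gexp a b x) + (2 * of_real pi * b) * gexp a b x" for x
    by (simp add: algebra_simps)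
  have "(LINT x|lborel. (- 2 * of_real pi * a * of_real x + 2 * of_real pi * b) * gexp a b x) = 0 - 0"
  proof (rule integral_FTC_real_line[OF gexp_has_vector_derivative])
    show "isCont (\<lambda>x. (- 2 * of_real pi * a * of_real x + 2 * of_real pi * b) * gexp a b x) x" for x
      by (intro continuous_intros isCont_gexp)
    show "integrable lborel (\<lambda>x. (- 2 * of_real pi * a * of_real x + 2 * of_real pi * b) * gexp a b x)"
      unfolding eq using i by (intro Bochner_Integration.integrable_add integrable_mult_right)
  qed (use power_gexp_tendsto_0[OF assms, of _ 0 b] in auto)
  then have "(- 2 * of_real pi * a) * (LINT x|lborel. of_real x * gexp a b x) + (2 * of_real pi * b) * gint a b = 0"
    unfolding eq gint_def using i by simp
  then have "2 * of_real pi * (a * (LINT x|lborel. of_real x * gexp a b x)) = 2 * of_real pi * (b * gint a b)"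
    by (simp add: algebra_simps)
  then show ?thesis by simp
qed

text \<open>Integration by parts: the derivative of \<open>x * gexp a 0 x\<close> integrates to
  0.\<close>

lemma gint_moment_2:
  assumes "Re a > 0"
  shows "2 * of_real pi * a * (LINT x|lborel. of_real x ^ 2 * gexp a 0 x) = gint a 0"
proof -
  have i: "integrable lborel (gexp a 0)" "integrable lborel (\<lambda>x. of_real x ^ 2 * gexp a 0 x)"
    using integrable_gexp[OF assms] integrable_power_gexp[OF assms, of 2] by auto
  let ?f = "\<lambda>x. gexp a 0 x + (- 2 * of_real pi * a) * (of_real x ^ 2 * gexp a 0 x)"
  have "(LINT x|lborel. ?f x) = 0 - 0"
  proof (rule integral_FTC_real_line)
    show "((\<lambda>x. of_real x * gexp a 0 x) has_vector_derivative ?f x) (at x)" for x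
      using has_vector_derivative_mult[OF has_vector_derivative_of_real[OF DERIV_ident] gexp_has_vector_derivative, of a 0 x UNIV]
      by (simp add: power2_eq_square algebra_simps)
    show "isCont ?f x" for x
      by (intro continuous_intros isCont_gexp)
    show "integrable lborel ?f"
      using i by (intro Bochner_Integration.integrable_add integrable_mult_right)
  qed (use power_gexp_tendsto_0[OF assms, of _ 1 0] in auto)
  then show ?thesis
    unfolding gint_def using i by (simp add: algebra_simps)
qed

lemma gint_has_field_derivative_right:
  assumes a: "Re a > 0"
  shows "(gint a has_field_derivative 2 * of_real pi * b / a * gint a b) (at b)"
proof -
  let ?p = "\<lambda>x::real. 2 * of_real pi * of_real x :: complex"
  have *: "gexp a (b + h) x = gexp a b x * exp (h * ?p x)" for h x
    using gexp_add[of a 0 b h x] by (simp add: gexp_def algebra_simps)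
  have i1: "integrable lborel (\<lambda>x. of_real x * gexp a b x)"
    using integrable_power_gexp[OF a, of 1] by simp
  have "((\<lambda>h. LINT x|lborel. gexp a b x * exp (h * ?p x)) has_field_derivative
      (LINT x|lborel. gexp a b x * ?p x)) (at 0)"
  proof (rule integral_exp_has_field_derivative[where r=1])
    show "integrable lborel (\<lambda>x. gexp a b x * exp (h * ?p x))" for h
      unfolding *[symmetric] by (rule integrable_gexp[OF a])
    show "integrable lborel (\<lambda>x. gexp a b x * ?p x)"
      using integrable_mult_right[OF i1, of "2 * of_real pi"] by (simp add: algebra_simps)
    obtain C where C: "C > 0"
      "\<And>x. \<bar>x\<bar> ^ 2 * exp (2 * pi * \<bar>x\<bar>) * norm (gexp a b x) \<le> C * exp (- (pi * Re a / 2 * x\<^sup>2))"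
      using power_gexp_bound[OF a, of "2 * pi" 2 b] by (metis mult_nonneg_nonneg pi_ge_zero zero_le_numeral)
    show "integrable lborel (\<lambda>x. norm (gexp a b x) * (norm (?p x))\<^sup>2 * exp (1 * norm (?p x)))"
    proof (rule Bochner_Integration.integrable_bound)
      show "integrable lborel (\<lambda>x. (4 * pi\<^sup>2) * (C * exp (- (pi * Re a / 2 * x\<^sup>2))))"
        using a by (intro integrable_mult_right integrable_exp_neg_square) auto
      have "norm (gexp a b x) * (norm (?p x))\<^sup>2 * exp (1 * norm (?p x))
          \<le> (4 * pi\<^sup>2) * (C * exp (- (pi * Re a / 2 * x\<^sup>2)))" for x
      proof -
        have "norm (gexp a b x) * (norm (?p x))\<^sup>2 * exp (1 * norm (?p x)) =
          (4 * pi\<^sup>2) * (\<bar>x\<bar> ^ 2 * exp (2 * pi * \<bar>x\<bar>) * norm (gexp a b x))"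
          by (simp add: norm_mult power_mult_distrib)
        also have "\<dots> \<le> (4 * pi\<^sup>2) * (C * exp (- (pi * Re a / 2 * x\<^sup>2)))"
          by (intro mult_left_mono C) auto
        finally show ?thesis .
      qed
      then show "AE x in lborel. norm (norm (gexp a b x) * (norm (?p x))\<^sup>2 * exp (1 * norm (?p x)))
          \<le> norm ((4 * pi\<^sup>2) * (C * exp (- (pi * Re a / 2 * x\<^sup>2))))"
        using C(1) by (auto intro!: AE_I2)
    qed measurable
  qed auto
  also have "(\<lambda>h. LINT x|lborel. gexp a b x * exp (h * ?p x)) = (\<lambda>h. gint a (b + h))"
    unfolding *[symmetric] gint_def ..
  also have "(LINT x|lborel. gexp a b x * ?p x) = 2 * of_real pi * (LINT x|lborel. of_real x * gexp a b x)"
    by (subst integral_mult_right_zero[symmetric]) (simp add: algebra_simps)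
  also have "\<dots> = 2 * of_real pi * b / a * gint a b"
  proof -
    have "a \<noteq> 0" using a by auto
    then have "(LINT x|lborel. of_real x * gexp a b x) = b * gint a b / a"
      using gint_moment_1[OF a, of b] by (simp add: field_simps)
    then show ?thesis by simp
  qed
  finally show ?thesis
    using DERIV_shift[of "gint a" _ 0 b] by (simp add: add.commute)
qed

text \<open>Differentiation in \<open>b\<close> produces the first moment, which is a multiple of
  \<open>gint a b\<close> again. This linear differential equation is solved by an integrating
  factor, in place of a contour shift by the complex number \<open>b / a\<close>.\<close>

lemma gint_eq:
  assumes a: "Re a > 0"
  shows "gint a b = gint a 0 * exp (of_real pi * b\<^sup>2 / a)"
proof -
  have [simp]: "a \<noteq> 0" using a by auto
  have "((\<lambda>b. gint a b * exp (- (of_real pi * b\<^sup>2 / a))) has_field_derivative 0) (at b)" for b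
  proof -
    have "((\<lambda>b. - (of_real pi * b\<^sup>2 / a)) has_field_derivative - (2 * of_real pi * b / a)) (at b)"
      by (auto intro!: derivative_eq_intros)
    from DERIV_mult[OF gint_has_field_derivative_right[OF a] DERIV_fun_exp[OF this]]
    show ?thesis by (simp add: algebra_simps)
  qed
  then obtain c where c: "\<And>b. gint a b * exp (- (of_real pi * b\<^sup>2 / a)) = c"
    using has_field_derivative_zero_constant[of UNIV "\<lambda>b. gint a b * exp (- (of_real pi * b\<^sup>2 / a))"] by auto
  have "gint a b * exp (- (of_real pi * b\<^sup>2 / a)) = gint a 0"
    using c[of b] c[of 0] by simp
  then show ?thesis
    by (simp add: exp_minus field_simps)
qed

lemma gint_has_field_derivative_left:
  assumes a: "Re a > 0"
  shows "((\<lambda>a. gint a 0) has_field_derivative - gint a 0 / (2 * a)) (at a)"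
proof -
  let ?p = "\<lambda>x::real. - of_real pi * of_real x ^ 2 :: complex"
  have *: "gexp (a + h) 0 x = gexp a 0 x * exp (h * ?p x)" for h x
    using gexp_add[of a h 0 0 x] by (simp add: gexp_def algebra_simps)
  have i1: "integrable lborel (\<lambda>x. of_real x ^ 2 * gexp a 0 x)"
    using integrable_power_gexp[OF a, of 2] by simp
  have "((\<lambda>h. LINT x|lborel. gexp a 0 x * exp (h * ?p x)) has_field_derivative
      (LINT x|lborel. gexp a 0 x * ?p x)) (at 0)"
  proof (rule integral_exp_has_field_derivative[where r="Re a / 2"])
    show "integrable lborel (\<lambda>x. gexp a 0 x * exp (h * ?p x))" if "norm h < Re a / 2" for h
      unfolding *[symmetric]
    proof (rule integrable_gexp)
      show "0 < Re (a + h)" using abs_Re_le_cmod[of h] a that by auto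
    qed
    show "integrable lborel (\<lambda>x. gexp a 0 x * ?p x)"
      using integrable_mult_right[OF i1, of "- of_real pi"] by (simp add: algebra_simps)
    \<comment> \<open>The factor \<open>exp (Re a / 2 * norm (?p x))\<close> uses up half of the
      decay, so the majorant is a fourth moment of the Gaussian with parameter
      \<open>Re a / 2\<close>.\<close>
    have "integrable lborel (\<lambda>x. norm (of_real (pi\<^sup>2) * (of_real x ^ 4 * gexp (of_real (Re a / 2)) 0 x)))"
      using a by (intro integrable_norm integrable_mult_right integrable_power_gexp) auto
    also have "(\<lambda>x. norm (of_real (pi\<^sup>2) * (of_real x ^ 4 * gexp (of_real (Re a / 2)) 0 x))) =
        (\<lambda>x. norm (gexp a 0 x) * (norm (?p x))\<^sup>2 * exp (Re a / 2 * norm (?p x)))"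
      by (rule ext) (simp add: norm_mult norm_power norm_gexp power_mult_distrib exp_add[symmetric] algebra_simps)
    finally show "integrable lborel (\<lambda>x. norm (gexp a 0 x) * (norm (?p x))\<^sup>2 * exp (Re a / 2 * norm (?p x)))" .
  qed (use a in auto)
  also have "(\<lambda>h. LINT x|lborel. gexp a 0 x * exp (h * ?p x)) = (\<lambda>h. gint (a + h) 0)"
    unfolding *[symmetric] gint_def ..
  also have "(LINT x|lborel. gexp a 0 x * ?p x) = - of_real pi * (LINT x|lborel. of_real x ^ 2 * gexp a 0 x)"
    by (subst integral_mult_right_zero[symmetric]) (simp add: algebra_simps)
  also have "\<dots> = - gint a 0 / (2 * a)"
    proof -
    have "a \<noteq> 0" using a by auto
    then show ?thesis unfolding gint_moment_2[OF a, symmetric] by simp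
  qed
  finally show ?thesis
    using DERIV_shift[of "\<lambda>a. gint a 0" _ 0 a] by (simp add: add.commute)
qed

text \<open>The product has derivative 0 on the right half-plane, which is convex, and the real
  Gaussian integral gives its value at 1. The square avoids choosing a branch of the square root of
  \<open>a\<close>; it determines the modulus of \<open>gint a 0\<close>, which is what the final
  estimate requires.\<close>

lemma gint_square:
  assumes a: "Re a > 0"
  shows "(gint a 0)\<^sup>2 * a = 1"
proof -
  let ?S = "{a. 0 < Re a}"
  have "((\<lambda>a. gint a 0 * gint a 0 * a) has_field_derivative 0) (at a within ?S)" if "a \<in> ?S" for a
  proof -
    have "a \<noteq> 0" and "Re a > 0" using that by auto
    note d = gint_has_field_derivative_left[OF this(2)]
    have "((\<lambda>a. gint a 0 * gint a 0 * a) has_field_derivative 0) (at a)"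
      by (rule DERIV_cong[OF DERIV_mult[OF DERIV_mult[OF d d] DERIV_ident]]) (use \<open>a \<noteq> 0\<close> in simp)
    then show ?thesis
      by (rule has_field_derivative_at_within)
  qed
  then obtain c where c: "\<And>a. a \<in> ?S \<Longrightarrow> gint a 0 * gint a 0 * a = c"
    using has_field_derivative_zero_constant[OF convex_halfspace_Re_gt[of 0],
        of "\<lambda>a. gint a 0 * gint a 0 * a"] by meson
  have "gint 1 0 = of_real (LINT x|lborel. exp (- (pi * x\<^sup>2)))"
    unfolding gint_def gexp_def integral_complex_of_real[symmetric]
    by (simp add: exp_of_real[symmetric])
  then have "gint 1 0 = 1"
    using integrable_exp_neg_square(2)[of pi] by simp
  then show ?thesis
    using c[of 1] c[of a] a by (simp add: power2_eq_square)
qed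

lemma norm_gint_0:
  assumes "Re a > 0"
  shows "norm (gint a 0) = 1 / sqrt (norm a)"
proof -
  have "(norm (gint a 0))\<^sup>2 * norm a = 1"
    using arg_cong[OF gint_square[OF assms], of norm] by (simp add: norm_mult norm_power)
  then have "sqrt ((norm (gint a 0))\<^sup>2 * norm a) = 1" by simp
  then have "norm (gint a 0) * sqrt (norm a) = 1" by (simp add: real_sqrt_mult)
  moreover have "norm a \<noteq> 0" using assms by auto
  ultimately show ?thesis by (simp add: field_simps)
qed

lemma fourier_gexp:
  assumes "Re z > 0"
  shows "fourier (gexp z 0) \<xi> = gint z 0 * gexp (inverse z) 0 \<xi>"
proof -
  have "fourier (gexp z 0) \<xi> = gint z (- \<i> * of_real \<xi>)"
    unfolding fourier_def gint_def
    by (intro Bochner_Integration.integral_cong refl) (simp add: gexp_def exp_add[symmetric] algebra_simps)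
  also have "\<dots> = gint z 0 * gexp (inverse z) 0 \<xi>"
    by (subst gint_eq[OF assms]) (simp add: gexp_def power_mult_distrib field_simps)
  finally show ?thesis .
qed

section \<open>Gaussians are Schwartz functions\<close>

lemma poly_gexp_has_vector_derivative:
  "((\<lambda>x. poly p (of_real x) * gexp z 0 x) has_vector_derivative
    poly (pderiv p + [:0, - 2 * of_real pi * z:] * p) (of_real x) * gexp z 0 x) (at x)"
proof -
  have "((\<lambda>x. poly p (of_real x)) has_vector_derivative poly (pderiv p) (of_real x)) (at x)"
    by (rule has_vector_derivative_real_field[OF poly_DERIV])
  from has_vector_derivative_mult[OF this gexp_has_vector_derivative, of z 0]
  show ?thesis by (simp add: algebra_simps)
qed

text \<open>The form polynomial times Gaussian reduces the decay of all derivatives to that of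
  single monomials times the Gaussian.\<close>

lemma higher_vector_derivative_gexp:
  "\<exists>p. higher_vector_derivative k (gexp z 0) = (\<lambda>x. poly p (of_real x) * gexp z 0 x)"
proof (induction k)
  case 0
  show ?case by (intro exI[of _ 1]) auto
next
  case (Suc k)
  then obtain p where p: "higher_vector_derivative k (gexp z 0) = (\<lambda>x. poly p (of_real x) * gexp z 0 x)"
    by blast
  have "higher_vector_derivative (Suc k) (gexp z 0) =
    (\<lambda>x. vector_derivative (\<lambda>x. poly p (of_real x) * gexp z 0 x) (at x))"
    by (simp add: p)
  also have "\<dots> = (\<lambda>x. poly (pderiv p + [:0, - 2 * of_real pi * z:] * p) (of_real x) * gexp z 0 x)"
    by (intro ext vector_derivative_at poly_gexp_has_vector_derivative)
  finally show ?case by blast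
qed

lemma schwartz_gexp:
  assumes "Re z > 0"
  shows "schwartz (gexp z 0)"
  unfolding schwartz_def
proof (intro conjI allI)
  fix k x
  obtain p where p: "higher_vector_derivative k (gexp z 0) = (\<lambda>x. poly p (of_real x) * gexp z 0 x)"
    using higher_vector_derivative_gexp by blast
  show "higher_vector_derivative k (gexp z 0) differentiable at x"
    unfolding p by (rule differentiableI_vector[OF poly_gexp_has_vector_derivative])
next
  fix k m
  obtain p where p: "higher_vector_derivative k (gexp z 0) = (\<lambda>x. poly p (of_real x) * gexp z 0 x)"
    using higher_vector_derivative_gexp by blast
  have "\<exists>C. \<forall>x. \<bar>x\<bar> ^ m * norm (of_real x ^ i * gexp z 0 x) \<le> C" for i
  proof -
    obtain C where C: "C > 0" "\<And>x. \<bar>x\<bar> ^ (m + i) * exp (0 * \<bar>x\<bar>) * norm (gexp z 0 x)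
        \<le> C * exp (- (pi * Re z / 2 * x\<^sup>2))"
      using power_gexp_bound[OF assms order_refl] by metis
    have "\<bar>x\<bar> ^ m * norm (of_real x ^ i * gexp z 0 x) \<le> C" for x
    proof -
      have "\<bar>x\<bar> ^ m * norm (of_real x ^ i * gexp z 0 x) \<le> C * exp (- (pi * Re z / 2 * x\<^sup>2))"
        using C(2)[of x] by (simp add: norm_mult norm_power power_add mult.assoc)
      also have "\<dots> \<le> C * 1"
        using C(1) assms by (intro mult_left_mono) auto
      finally show ?thesis by simp
    qed
    then show ?thesis by blast
  qed
  then obtain C where C: "\<And>i x. \<bar>x\<bar> ^ m * norm (of_real x ^ i * gexp z 0 x) \<le> C i"
    by metis
  have "\<bar>x\<bar> ^ m * norm (higher_vector_derivative k (gexp z 0) x) \<le> (\<Sum>i\<le>degree p. norm (coeff p i) * C i)" for x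
  proof -
    have "\<bar>x\<bar> ^ m * norm (higher_vector_derivative k (gexp z 0) x) =
        \<bar>x\<bar> ^ m * norm (\<Sum>i\<le>degree p. coeff p i * (of_real x ^ i * gexp z 0 x))"
      unfolding p by (simp add: poly_altdef sum_distrib_right mult.assoc)
    also have "\<dots> \<le> \<bar>x\<bar> ^ m * (\<Sum>i\<le>degree p. norm (coeff p i) * norm (of_real x ^ i * gexp z 0 x))"
      by (intro mult_left_mono sum_norm_le) (auto simp: norm_mult)
    also have "\<dots> = (\<Sum>i\<le>degree p. norm (coeff p i) * (\<bar>x\<bar> ^ m * norm (of_real x ^ i * gexp z 0 x)))"
      by (simp add: sum_distrib_left mult_ac)
    also have "\<dots> \<le> (\<Sum>i\<le>degree p. norm (coeff p i) * C i)"
      by (intro sum_mono mult_left_mono C) auto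
    finally show ?thesis .
  qed
  then show "\<exists>B. \<forall>x. \<bar>x\<bar> ^ m * norm (higher_vector_derivative k (gexp z 0) x) \<le> B"
    by blast
qed

section \<open>Linear images of products of Gaussians\<close>

text \<open>Parametrised by a complex variance (up to the factor \<open>2 * pi\<close>) and a
  complex centre, because these two add under convolution, unlike the coefficients of
  \<open>gexp\<close>.\<close>

definition gauss :: "complex \<Rightarrow> complex \<Rightarrow> real \<Rightarrow> complex" where
  "gauss w \<mu> u = exp (- (of_real pi * (of_real u - \<mu>)\<^sup>2 / w))"

lemma gauss_eq_gexp:
  assumes "w \<noteq> 0"
  shows "gauss w \<mu> u = exp (- (of_real pi * \<mu>\<^sup>2 / w)) * gexp (inverse w) (\<mu> / w) u"
  using assms unfolding gauss_def gexp_def exp_add[symmetric]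
  by (intro arg_cong[of _ _ exp]) (simp add: field_simps power2_eq_square)

lemma Re_inverse_pos: "Re w > 0 \<Longrightarrow> Re (inverse w) > 0"
  by (auto simp: sum_power2_gt_zero_iff intro!: divide_pos_pos)

lemma measurable_gauss [measurable]:
  assumes [measurable]: "f \<in> borel_measurable M"
  shows "(\<lambda>x. gauss w \<mu> (f x)) \<in> borel_measurable M"
  unfolding gauss_def by measurable

lemma integrable_gauss:
  assumes "Re w > 0"
  shows "integrable lborel (gauss w \<mu>)"
proof -
  have "w \<noteq> 0" using assms by auto
  then have "gauss w \<mu> = (\<lambda>u. exp (- (of_real pi * \<mu>\<^sup>2 / w)) * gexp (inverse w) (\<mu> / w) u)"
    by (intro ext gauss_eq_gexp)
  then show ?thesis
    using integrable_gexp[OF Re_inverse_pos[OF assms]] by simp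
qed

lemma gauss_scale:
  assumes "\<beta> \<noteq> 0"
  shows "gauss ((of_real \<beta>)\<^sup>2 * z) (of_real \<beta> * \<mu>) (\<beta> * u) = gauss z \<mu> u"
proof -
  have "of_real (\<beta> * u) - of_real \<beta> * \<mu> = of_real \<beta> * (of_real u - \<mu>)"
    by (simp add: algebra_simps)
  then show ?thesis
    using assms by (simp add: gauss_def power_mult_distrib)
qed

text \<open>Completing the square in \<open>u\<close>: the inverse variances add in the integrand,
  and eliminating \<open>u\<close> makes the variances themselves add.\<close>

lemma gauss_convolution:
  assumes v: "Re v > 0" and w: "Re w > 0"
  shows "(LINT u|lborel. gauss w \<mu> u * gauss v \<nu> (t - u)) =
    gint (inverse v + inverse w) 0 * gauss (v + w) (\<mu> + \<nu>) t"
proof -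
  have nz: "v \<noteq> 0" "w \<noteq> 0" "v + w \<noteq> 0"
    using assms by (auto simp: complex_eq_iff)
  have a: "Re (inverse v + inverse w) > 0"
    using Re_inverse_pos[OF v] Re_inverse_pos[OF w] by simp
  have "gauss w \<mu> u * gauss v \<nu> (t - u) =
     exp (- (of_real pi * \<mu>\<^sup>2 / w) - of_real pi * (of_real t - \<nu>)\<^sup>2 / v) *
       gexp (inverse v + inverse w) (\<mu> / w + (of_real t - \<nu>) / v) u" for u
    unfolding gauss_def gexp_def exp_add[symmetric] using nz
    by (intro arg_cong[of _ _ exp]) (simp add: field_simps power2_eq_square)
  then have "(LINT u|lborel. gauss w \<mu> u * gauss v \<nu> (t - u)) =
    exp (- (of_real pi * \<mu>\<^sup>2 / w) - of_real pi * (of_real t - \<nu>)\<^sup>2 / v) *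
      gint (inverse v + inverse w) (\<mu> / w + (of_real t - \<nu>) / v)"
    by (simp add: gint_def)
  also have "\<dots> = gint (inverse v + inverse w) 0 *
    (exp (- (of_real pi * \<mu>\<^sup>2 / w) - of_real pi * (of_real t - \<nu>)\<^sup>2 / v) *
      exp (of_real pi * (\<mu> / w + (of_real t - \<nu>) / v)\<^sup>2 / (inverse v + inverse w)))"
    by (subst gint_eq[OF a]) (simp add: mult_ac)
  also have "exp (- (of_real pi * \<mu>\<^sup>2 / w) - of_real pi * (of_real t - \<nu>)\<^sup>2 / v) *
      exp (of_real pi * (\<mu> / w + (of_real t - \<nu>) / v)\<^sup>2 / (inverse v + inverse w)) = gauss (v + w) (\<mu> + \<nu>) t"
  proof -
    have "- (p * \<mu>\<^sup>2 / w) - p * s\<^sup>2 / v + p * (\<mu> / w + s / v)\<^sup>2 / (inverse v + inverse w) =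
      - (p * (s - \<mu>)\<^sup>2 / (v + w))" for s p
    proof -
      have i: "inverse v + inverse w = (v + w) / (v * w)"
        using nz by (simp add: field_simps)
      show ?thesis
        unfolding i using nz by (simp add: divide_simps) (simp add: algebra_simps power2_eq_square)
    qed
    from this[of "of_real pi" "of_real t - \<nu>"]
    have eq: "- (of_real pi * \<mu>\<^sup>2 / w) - of_real pi * (of_real t - \<nu>)\<^sup>2 / v +
        of_real pi * (\<mu> / w + (of_real t - \<nu>) / v)\<^sup>2 / (inverse v + inverse w) =
      - (of_real pi * (of_real t - (\<mu> + \<nu>))\<^sup>2 / (v + w))"
      by (simp only: diff_diff_eq add.commute[of \<mu> \<nu>])
    show ?thesis
      by (simp only: gauss_def exp_add[symmetric] eq)
  qed
  finally show ?thesis .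
qed

lemma norm_gint_inverse_add:
  assumes v: "Re v > 0" and w: "Re w > 0"
  shows "norm (gint (inverse v + inverse w) 0) = sqrt (norm v * norm w / norm (v + w))"
proof -
  have nz: "v \<noteq> 0" "w \<noteq> 0" "v + w \<noteq> 0"
    using assms by (auto simp: complex_eq_iff)
  have i: "inverse v + inverse w = (v + w) / (v * w)"
    using nz by (simp add: field_simps)
  have a: "Re (inverse v + inverse w) > 0"
    using Re_inverse_pos[OF v] Re_inverse_pos[OF w] by simp
  show ?thesis
    unfolding norm_gint_0[OF a] unfolding i
    by (simp add: norm_divide norm_mult real_sqrt_divide)
qed

text \<open>Two Gaussian variables inside a bounded function of \<open>u + \<beta> * y\<close> merge
  into one: substitute \<open>t = u + \<beta> * y\<close>, exchange the integrals and convolve. This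
  is the induction step for linear combinations of many variables.\<close>

lemma integral_gauss_convolution:
  fixes F :: "real \<Rightarrow> complex"
  assumes v: "Re v > 0" and w: "Re w > 0" and \<beta>: "\<beta> \<noteq> 0"
    and [measurable]: "F \<in> borel_measurable borel" and B: "\<And>u. norm (F u) \<le> B"
  shows "(LINT u|lborel. (LINT y|lborel. F (u + \<beta> * y) * gauss v \<nu> y) * gauss w \<mu> u) =
     of_real (1 / \<bar>\<beta>\<bar>) * gint (inverse (of_real \<beta> ^ 2 * v) + inverse w) 0 *
      (LINT t|lborel. F t * gauss (of_real \<beta> ^ 2 * v + w) (\<mu> + of_real \<beta> * \<nu>) t)"
proof -
  let ?v = "of_real \<beta> ^ 2 * v" and ?\<nu> = "of_real \<beta> * \<nu>"
  have v': "Re ?v > 0"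
    using v \<beta> by (simp flip: of_real_power)
  have B0: "0 \<le> B" using B[of 0] norm_ge_zero order_trans by blast
  let ?h = "\<lambda>u t. F t * gauss ?v ?\<nu> (t - u) * gauss w \<mu> u"
  have inner: "(LINT y|lborel. F (u + \<beta> * y) * gauss v \<nu> y) =
      of_real (1 / \<bar>\<beta>\<bar>) * (LINT t|lborel. F t * gauss ?v ?\<nu> (t - u))" for u
    using lborel_integral_real_affine[OF \<beta>, of "\<lambda>t. F t * gauss ?v ?\<nu> (t - u)" u] \<beta>
    by (simp add: gauss_scale[OF \<beta>] scaleR_conv_of_real)
  have shift: "integrable lborel (\<lambda>t. gauss ?v ?\<nu> (t - u))" for u
    using lborel_integrable_real_affine[OF integrable_gauss[OF v', of ?\<nu>], of 1 "-u"] by simp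
  have shift_int: "(LINT t|lborel. norm (gauss ?v ?\<nu> (t - u))) = (LINT t|lborel. norm (gauss ?v ?\<nu> t))" for u
    using lborel_integral_real_affine[of 1 "\<lambda>t. norm (gauss ?v ?\<nu> t)" "-u"] by simp
  have int: "integrable (lborel \<Otimes>\<^sub>M lborel) (case_prod ?h)"
  proof (rule Bochner_Integration.integrable_bound)
    show "integrable (lborel \<Otimes>\<^sub>M lborel) (\<lambda>(u, t). B *\<^sub>R (gauss ?v ?\<nu> (t - u) * gauss w \<mu> u))"
    proof (rule lborel_pair.Fubini_integrable)
      have "(LINT t|lborel. norm (B *\<^sub>R (gauss ?v ?\<nu> (t - u) * gauss w \<mu> u))) =
          (B * (LINT t|lborel. norm (gauss ?v ?\<nu> t))) * norm (gauss w \<mu> u)" for u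
        using B0 by (simp add: norm_mult shift_int)
      then show "integrable lborel (\<lambda>u. LINT t|lborel. norm (case (u, t) of (u, t) \<Rightarrow> B *\<^sub>R (gauss ?v ?\<nu> (t - u) * gauss w \<mu> u)))"
        using integrable_gauss[OF w, of \<mu>] by (simp add: integrable_norm)
      show "AE u in lborel. integrable lborel (\<lambda>t. case (u, t) of (u, t) \<Rightarrow> B *\<^sub>R (gauss ?v ?\<nu> (t - u) * gauss w \<mu> u))"
        using shift by (intro AE_I2) auto
    qed measurable
    show "AE x in lborel \<Otimes>\<^sub>M lborel. norm (case_prod ?h x) \<le>
        norm (case x of (u, t) \<Rightarrow> B *\<^sub>R (gauss ?v ?\<nu> (t - u) * gauss w \<mu> u))"
      using B B0 by (intro AE_I2) (auto simp: norm_mult mult.assoc intro!: mult_right_mono)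
  qed measurable
  have "(LINT u|lborel. (LINT y|lborel. F (u + \<beta> * y) * gauss v \<nu> y) * gauss w \<mu> u) =
      of_real (1 / \<bar>\<beta>\<bar>) * (LINT u|lborel. LINT t|lborel. ?h u t)"
  proof -
    have "(LINT t|lborel. ?h u t) = (LINT t|lborel. F t * gauss ?v ?\<nu> (t - u)) * gauss w \<mu> u" for u
      by (rule integral_mult_left_zero)
    then show ?thesis
      unfolding inner by (simp only: mult.assoc integral_mult_right_zero)
  qed
  also have "(LINT u|lborel. LINT t|lborel. ?h u t) = (LINT t|lborel. LINT u|lborel. ?h u t)"
    by (rule lborel_pair.Fubini_integral[symmetric, OF int])
  also have "\<dots> = (LINT t|lborel. F t * (LINT u|lborel. gauss w \<mu> u * gauss ?v ?\<nu> (t - u)))"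
    by (simp add: mult_ac)
  also have "\<dots> = gint (inverse ?v + inverse w) 0 *
      (LINT t|lborel. F t * gauss (?v + w) (\<mu> + ?\<nu>) t)"
    unfolding gauss_convolution[OF v' w]
    by (subst integral_mult_right_zero[symmetric]) (simp only: mult.left_commute)
  finally show ?thesis by (simp add: mult.assoc)
qed

interpretation lborel_product: product_sigma_finite "\<lambda>_. lborel :: real measure" ..

lemma integrable_prod_gauss:
  assumes "finite J" "\<And>j. j \<in> J \<Longrightarrow> Re (z j) > 0"
    and [measurable]: "G \<in> borel_measurable (\<Pi>\<^sub>M j\<in>J. lborel)" and B: "\<And>x. norm (G x) \<le> B"
  shows "integrable (\<Pi>\<^sub>M j\<in>J. lborel) (\<lambda>x. G x * (\<Prod>j\<in>J. gauss (z j) (\<mu> j) (x j)))"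
proof (rule Bochner_Integration.integrable_bound)
  show "integrable (\<Pi>\<^sub>M j\<in>J. lborel) (\<lambda>x. B *\<^sub>R (\<Prod>j\<in>J. gauss (z j) (\<mu> j) (x j)))"
    using assms by (intro integrable_scaleR_right lborel_product.product_integrable_prod integrable_gauss) auto
  show "AE x in (\<Pi>\<^sub>M j\<in>J. lborel). norm (G x * (\<Prod>j\<in>J. gauss (z j) (\<mu> j) (x j))) \<le>
      norm (B *\<^sub>R (\<Prod>j\<in>J. gauss (z j) (\<mu> j) (x j)))"
    using B by (intro AE_I2) (auto simp: norm_mult intro!: mult_right_mono order_trans[OF B abs_ge_self])
qed measurable

text \<open>The law of a linear combination of independent Gaussians, continued to complex
  variances. One \<open>K\<close> serves all \<open>F\<close>; only its modulus is recorded, since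
  its phase would require square roots of complex numbers.\<close>

lemma integral_sum_prod_gauss:
  fixes \<beta> :: "'i \<Rightarrow> real" and z \<mu> :: "'i \<Rightarrow> complex"
  assumes "finite J" "J \<noteq> {}" "\<And>j. j \<in> J \<Longrightarrow> \<beta> j \<noteq> 0" "\<And>j. j \<in> J \<Longrightarrow> Re (z j) > 0"
  shows "\<exists>K. norm K = sqrt ((\<Prod>j\<in>J. norm (z j)) / norm (\<Sum>j\<in>J. of_real (\<beta> j) ^ 2 * z j)) \<and>
    (\<forall>F. F \<in> borel_measurable borel \<longrightarrow> (\<exists>B. \<forall>u. norm (F u) \<le> B) \<longrightarrow>
      (LINT \<xi>|(\<Pi>\<^sub>M j\<in>J. lborel). F (\<Sum>j\<in>J. \<beta> j * \<xi> j) * (\<Prod>j\<in>J. gauss (z j) (\<mu> j) (\<xi> j))) =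
      K * (LINT u|lborel. F u * gauss (\<Sum>j\<in>J. of_real (\<beta> j) ^ 2 * z j) (\<Sum>j\<in>J. of_real (\<beta> j) * \<mu> j) u))"
  using assms
proof (induction J rule: finite_ne_induct)
  case (singleton i)
  then have \<beta>: "\<beta> i \<noteq> 0" and z: "z i \<noteq> 0" by auto
  show ?case
  proof (intro exI conjI allI impI)
    show "norm (of_real (1 / \<bar>\<beta> i\<bar>) :: complex) =
        sqrt ((\<Prod>j\<in>{i}. norm (z j)) / norm (\<Sum>j\<in>{i}. of_real (\<beta> j) ^ 2 * z j))"
      using z by (simp add: norm_mult norm_power norm_divide real_sqrt_divide)
    fix F :: "real \<Rightarrow> complex" assume [measurable]: "F \<in> borel_measurable borel"
    have "(LINT \<xi>|(\<Pi>\<^sub>M j\<in>{i}. lborel). F (\<beta> i * \<xi> i) * gauss (z i) (\<mu> i) (\<xi> i)) =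
      (LINT y|lborel. F (\<beta> i * y) * gauss (z i) (\<mu> i) y)"
      by (rule lborel_product.product_integral_singleton) measurable
    then show "(LINT \<xi>|(\<Pi>\<^sub>M j\<in>{i}. lborel). F (\<Sum>j\<in>{i}. \<beta> j * \<xi> j) * (\<Prod>j\<in>{i}. gauss (z j) (\<mu> j) (\<xi> j))) =
      of_real (1 / \<bar>\<beta> i\<bar>) * (LINT u|lborel. F u *
        gauss (\<Sum>j\<in>{i}. of_real (\<beta> j) ^ 2 * z j) (\<Sum>j\<in>{i}. of_real (\<beta> j) * \<mu> j) u)"
      using lborel_integral_real_affine[OF \<beta>, of "\<lambda>u. F u * gauss ((of_real (\<beta> i))\<^sup>2 * z i) (of_real (\<beta> i) * \<mu> i) u" 0] \<beta>
      by (simp add: gauss_scale[OF \<beta>] scaleR_conv_of_real)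
  qed
next
  case (insert i J)
  let ?w = "\<Sum>j\<in>J. of_real (\<beta> j) ^ 2 * z j" and ?\<mu> = "\<Sum>j\<in>J. of_real (\<beta> j) * \<mu> j"
  have \<beta>: "\<beta> i \<noteq> 0" and z: "Re (z i) > 0" using insert.prems by auto
  have w: "Re ?w > 0"
    using insert unfolding Re_sum by (intro sum_pos) (auto simp flip: of_real_power)
  have v: "Re (of_real (\<beta> i) ^ 2 * z i) > 0"
    using z \<beta> by (simp flip: of_real_power)
  obtain K where K: "norm K = sqrt ((\<Prod>j\<in>J. norm (z j)) / norm ?w)"
    "\<And>F. F \<in> borel_measurable borel \<Longrightarrow> (\<exists>B. \<forall>u. norm (F u) \<le> B) \<Longrightarrow>
      (LINT \<xi>|(\<Pi>\<^sub>M j\<in>J. lborel). F (\<Sum>j\<in>J. \<beta> j * \<xi> j) * (\<Prod>j\<in>J. gauss (z j) (\<mu> j) (\<xi> j))) =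
      K * (LINT u|lborel. F u * gauss ?w ?\<mu> u)"
    using insert.IH insert.prems by auto
  let ?L = "of_real (1 / \<bar>\<beta> i\<bar>) * gint (inverse (of_real (\<beta> i) ^ 2 * z i) + inverse ?w) 0"
  show ?case
  proof (intro exI conjI allI impI)
    have "?w \<noteq> 0" using w by (metis less_irrefl zero_complex.sel(1))
    \<comment> \<open>The modulus telescopes: \<open>norm ?w\<close> cancels the denominator of the
      induction hypothesis, and \<open>1 / \<bar>\<beta> i\<bar>\<close> cancels the scaling of the
      new variance.\<close>
    have "norm (K * ?L) = sqrt ((\<Prod>j\<in>J. norm (z j)) / norm ?w) *
        (1 / \<bar>\<beta> i\<bar> * sqrt (norm (of_real (\<beta> i) ^ 2 * z i) * norm ?w / norm (of_real (\<beta> i) ^ 2 * z i + ?w)))"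
      by (simp only: norm_mult K(1) norm_gint_inverse_add[OF v w] norm_of_real abs_divide abs_one abs_abs)
    also have "\<dots> = sqrt (norm (z i) * (\<Prod>j\<in>J. norm (z j)) / norm (of_real (\<beta> i) ^ 2 * z i + ?w))"
      using \<open>?w \<noteq> 0\<close> \<beta> by (simp add: norm_mult norm_power real_sqrt_mult real_sqrt_divide)
    finally show "norm (K * ?L) = sqrt ((\<Prod>j\<in>insert i J. norm (z j)) / norm (\<Sum>j\<in>insert i J. of_real (\<beta> j) ^ 2 * z j))"
      unfolding sum.insert[OF insert.hyps(1,3)] prod.insert[OF insert.hyps(1,3)] .
    fix F :: "real \<Rightarrow> complex" assume F[measurable]: "F \<in> borel_measurable borel" and "\<exists>B. \<forall>u. norm (F u) \<le> B"
    then obtain B where B: "\<And>u. norm (F u) \<le> B" by blast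
    \<comment> \<open>The induction hypothesis is applied not to \<open>F\<close> but to its average
      over the new variable, which is again bounded and measurable.\<close>
    let ?F = "\<lambda>s. LINT y|lborel. F (s + \<beta> i * y) * gauss (z i) (\<mu> i) y"
    have "(LINT \<xi>|(\<Pi>\<^sub>M j\<in>insert i J. lborel). F (\<Sum>j\<in>insert i J. \<beta> j * \<xi> j) * (\<Prod>j\<in>insert i J. gauss (z j) (\<mu> j) (\<xi> j))) =
      (LINT x|(\<Pi>\<^sub>M j\<in>J. lborel). LINT y|lborel. F (\<Sum>j\<in>insert i J. \<beta> j * (x(i:=y)) j) *
        (\<Prod>j\<in>insert i J. gauss (z j) (\<mu> j) ((x(i:=y)) j)))"
      using insert B
      by (intro lborel_product.product_integral_insert integrable_prod_gauss[where B=B]) (auto, measurable)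
    also have "\<dots> = (LINT x|(\<Pi>\<^sub>M j\<in>J. lborel). ?F (\<Sum>j\<in>J. \<beta> j * x j) * (\<Prod>j\<in>J. gauss (z j) (\<mu> j) (x j)))"
    proof (intro Bochner_Integration.integral_cong refl)
      fix x :: "'i \<Rightarrow> real"
      have *: "(\<Sum>j\<in>J. \<beta> j * (x(i:=y)) j) = (\<Sum>j\<in>J. \<beta> j * x j)"
        "(\<Prod>j\<in>J. gauss (z j) (\<mu> j) ((x(i:=y)) j)) = (\<Prod>j\<in>J. gauss (z j) (\<mu> j) (x j))" for y
        using insert.hyps(3) by (intro sum.cong prod.cong refl, metis fun_upd_other)+
      show "(LINT y|lborel. F (\<Sum>j\<in>insert i J. \<beta> j * (x(i:=y)) j) *
        (\<Prod>j\<in>insert i J. gauss (z j) (\<mu> j) ((x(i:=y)) j))) =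
        ?F (\<Sum>j\<in>J. \<beta> j * x j) * (\<Prod>j\<in>J. gauss (z j) (\<mu> j) (x j))"
        unfolding sum.insert[OF insert.hyps(1,3)] prod.insert[OF insert.hyps(1,3)] *
        by (subst integral_mult_left_zero[symmetric]) (simp add: mult_ac add.commute)
    qed
    also have "\<dots> = K * (LINT u|lborel. ?F u * gauss ?w ?\<mu> u)"
    proof (rule K(2))
      show "?F \<in> borel_measurable borel" by measurable
      have "norm (?F s) \<le> (LINT y|lborel. B * norm (gauss (z i) (\<mu> i) y))" for s
      proof (rule Bochner_Integration.integral_norm_bound_integral)
        show i: "integrable lborel (\<lambda>y. B * norm (gauss (z i) (\<mu> i) y))"
          using integrable_gauss[OF z] by (intro integrable_mult_right integrable_norm)
        show le: "norm (F (s + \<beta> i * y) * gauss (z i) (\<mu> i) y) \<le> B * norm (gauss (z i) (\<mu> i) y)" for y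
          using B by (simp add: norm_mult mult_right_mono)
        show "integrable lborel (\<lambda>y. F (s + \<beta> i * y) * gauss (z i) (\<mu> i) y)"
          by (rule Bochner_Integration.integrable_bound[OF i])
            (measurable, use le in \<open>auto intro!: AE_I2 order_trans[OF le abs_ge_self]\<close>)
      qed
      then show "\<exists>B. \<forall>u. norm (?F u) \<le> B" by blast
    qed
    also have "\<dots> = (K * ?L) * (LINT t|lborel. F t * gauss (of_real (\<beta> i) ^ 2 * z i + ?w) (?\<mu> + of_real (\<beta> i) * \<mu> i) t)"
      unfolding integral_gauss_convolution[OF z w \<beta> F B] by (simp add: mult.assoc)
    finally show "(LINT \<xi>|(\<Pi>\<^sub>M j\<in>insert i J. lborel). F (\<Sum>j\<in>insert i J. \<beta> j * \<xi> j) * (\<Prod>j\<in>insert i J. gauss (z j) (\<mu> j) (\<xi> j))) =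
      K * ?L * (LINT u|lborel. F u *
        gauss (\<Sum>j\<in>insert i J. of_real (\<beta> j) ^ 2 * z j) (\<Sum>j\<in>insert i J. of_real (\<beta> j) * \<mu> j) u)"
      unfolding sum.insert[OF insert.hyps(1,3)] by (simp add: add.commute)
  qed
qed

section \<open>Logarithmic growth of the wedge integral\<close>

text \<open>The derivative of \<open>gexp Q L\<close> is integrated over the half line; its boundary
  value 1 at 0 yields the leading term \<open>1 / (2 * pi * Q)\<close>.\<close>

lemma half_line_moment:
  assumes Q: "Re Q > 0"
  shows "(LINT u:{0<..}|lborel. of_real u * gexp Q L u) =
    1 / (2 * of_real pi * Q) + L / Q * (LINT u:{0<..}|lborel. gexp Q L u)"
proof -
  have "Q \<noteq> 0" using Q by auto
  have i: "set_integrable lborel {0<..} (gexp Q L)" "set_integrable lborel {0<..} (\<lambda>u. of_real u * gexp Q L u)"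
    using integrable_gexp[OF Q, of L] integrable_power_gexp[OF Q, of 1 L]
    unfolding set_integrable_def by (auto intro!: integrable_mult_indicator)
  have eq: "(- 2 * of_real pi * Q * of_real x + 2 * of_real pi * L) * gexp Q L x =
     (- 2 * of_real pi * Q) * (of_real x * gexp Q L x) + (2 * of_real pi * L) * gexp Q L x" for x
    by (simp add: algebra_simps)
  have "(LINT u:{0<..}|lborel. (- 2 * of_real pi * Q * of_real u + 2 * of_real pi * L) * gexp Q L u) = 0 - gexp Q L 0"
  proof (rule integral_FTC_half_line[OF gexp_has_vector_derivative])
    show "isCont (\<lambda>x. (- 2 * of_real pi * Q * of_real x + 2 * of_real pi * L) * gexp Q L x) x" for x
      by (intro continuous_intros isCont_gexp)
    show "integrable lborel (\<lambda>x. (- 2 * of_real pi * Q * of_real x + 2 * of_real pi * L) * gexp Q L x)"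
      unfolding eq using integrable_gexp[OF Q, of L] integrable_power_gexp[OF Q, of 1 L]
      by (intro Bochner_Integration.integrable_add integrable_mult_right) auto
  qed (use power_gexp_tendsto_0[OF Q, of _ 0 L] in auto)
  then have "(- 2 * of_real pi * Q) * (LINT u:{0<..}|lborel. of_real u * gexp Q L u) +
      (2 * of_real pi * L) * (LINT u:{0<..}|lborel. gexp Q L u) = - 1"
    unfolding eq using i by (simp add: set_integral_add)
  then show ?thesis
    using \<open>Q \<noteq> 0\<close> by (simp add: field_simps)
qed

text \<open>\<open>1 / sqrt (Re Q)\<close> is the width of the Gaussian, so the hypothesis on
  \<open>L\<close> is invariant under scaling and the linear term costs only a constant
  factor.\<close>

lemma half_line_bound:
  assumes Q: "Re Q > 0" and L: "norm L \<le> c * sqrt (Re Q)"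
  shows "norm (LINT u:{0<..}|lborel. gexp Q L u) \<le> exp (2 * pi * c\<^sup>2) * sqrt (2 / Re Q)"
proof -
  have le: "norm (gexp Q L u) \<le> exp (2 * pi * c\<^sup>2) * exp (- (pi * Re Q / 2 * u\<^sup>2))" for u
  proof -
    have "2 * pi * Re L * u \<le> 2 * pi * (norm L * \<bar>u\<bar>)"
    proof -
      have "Re L * u \<le> \<bar>Re L\<bar> * \<bar>u\<bar>" by (metis abs_ge_self abs_mult)
      also have "\<dots> \<le> norm L * \<bar>u\<bar>" by (intro mult_right_mono abs_Re_le_cmod) auto
      finally show ?thesis by (simp add: mult.assoc)
    qed
    also have "\<dots> \<le> 2 * pi * (c * sqrt (Re Q) * \<bar>u\<bar>)"
      using L by (intro mult_left_mono mult_right_mono) auto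
    also have "\<dots> = (2 * pi * c * sqrt (Re Q)) * \<bar>u\<bar>"
      by simp
    also have "\<dots> \<le> pi * Re Q / 2 * u\<^sup>2 + (2 * pi * c * sqrt (Re Q))\<^sup>2 / (4 * (pi * Re Q / 2))"
      using Q by (intro linear_le_quadratic) auto
    also have "(2 * pi * c * sqrt (Re Q))\<^sup>2 / (4 * (pi * Re Q / 2)) = 2 * pi * c\<^sup>2"
      using Q by (simp add: power_mult_distrib power2_eq_square[of pi])
    finally show ?thesis
      by (simp add: norm_gexp exp_add[symmetric] mult.commute mult.left_commute)
  qed
  have "norm (LINT u:{0<..}|lborel. gexp Q L u) \<le>
      (LINT u|lborel. exp (2 * pi * c\<^sup>2) * exp (- (pi * Re Q / 2 * u\<^sup>2)))"
    unfolding set_lebesgue_integral_def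
  proof (rule Bochner_Integration.integral_norm_bound_integral)
    show "integrable lborel (\<lambda>u. indicat_real {0<..} u *\<^sub>R gexp Q L u)"
      using integrable_gexp[OF Q, of L] by (auto intro!: integrable_mult_indicator)
    show "integrable lborel (\<lambda>u. exp (2 * pi * c\<^sup>2) * exp (- (pi * Re Q / 2 * u\<^sup>2)))"
      using Q by (intro integrable_mult_right integrable_exp_neg_square) auto
    show "norm (indicat_real {0<..} u *\<^sub>R gexp Q L u) \<le> exp (2 * pi * c\<^sup>2) * exp (- (pi * Re Q / 2 * u\<^sup>2))" for u
      using le[of u] by (auto simp: indicator_def)
  qed
  also have "\<dots> = exp (2 * pi * c\<^sup>2) * sqrt (2 / Re Q)"
    using integrable_exp_neg_square(2)[of "pi * Re Q / 2"] Q by simp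
  finally show ?thesis .
qed

text \<open>\<open>zvar l\<close> and \<open>wvar \<bar>\<alpha> n\<bar> s l\<close>, with \<open>s\<close> the sum of \<open>(\<alpha> j)\<^sup>2\<close> over \<open>j < n\<close>, are up to a factor
  \<open>2 \<pi>\<close> the complex variances of \<open>\<xi> n\<close> and of the sum of \<open>\<alpha> j * \<xi> j\<close> over \<open>j < n\<close> under the chirped Gaussian
  weight. Along the ray with slope \<open>k\<close> in the plane of these two variables the weight is
  \<open>gexp (wquad \<kappa> s l k) (wlin \<kappa> s b \<sigma> l x k)\<close>; the denominator \<open>wden\<close> of the reciprocal of \<open>wquad\<close> has size
  \<open>1 + l * (1 - \<kappa> * k)\<close>, which is where the factor \<open>ln l\<close> comes from.\<close>

definition zvar :: "real \<Rightarrow> complex" where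
  "zvar l = Complex 1 (- l)"

definition wvar :: "real \<Rightarrow> real \<Rightarrow> real \<Rightarrow> complex" where
  "wvar \<kappa> s l = Complex s (\<kappa>\<^sup>2 * l)"

definition wquad :: "real \<Rightarrow> real \<Rightarrow> real \<Rightarrow> real \<Rightarrow> complex" where
  "wquad \<kappa> s l k = inverse (wvar \<kappa> s l) + (of_real k)\<^sup>2 * inverse (zvar l)"

definition wlin :: "real \<Rightarrow> real \<Rightarrow> real \<Rightarrow> real \<Rightarrow> real \<Rightarrow> real \<Rightarrow> real \<Rightarrow> complex" where
  "wlin \<kappa> s b \<sigma> l x k = \<i> * of_real x * (of_real b / wvar \<kappa> s l - of_real (\<sigma> * k) / zvar l)"

definition wden :: "real \<Rightarrow> real \<Rightarrow> real \<Rightarrow> real \<Rightarrow> complex" where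
  "wden \<kappa> s l k = zvar l + (of_real k)\<^sup>2 * wvar \<kappa> s l"

text \<open>The constant in the bound of \<open>wlin\<close> by
  \<open>\<bar>x\<bar> * sqrt (Re wquad)\<close>: the 2 stems from
  \<open>(p + q)\<^sup>2 \<le> 2 * (p\<^sup>2 + q\<^sup>2)\<close>, and
  \<open>b\<^sup>2 / s + 1\<close> dominates the factors \<open>b\<^sup>2 / s\<close> and
  \<open>1\<close> of the two squares.\<close>

definition wconst :: "real \<Rightarrow> real \<Rightarrow> real" where
  "wconst s b = sqrt (2 * (b\<^sup>2 / s + 1))"

lemma measurable_wquad_wlin [measurable]: "wquad \<kappa> s l \<in> borel_measurable borel" "wlin \<kappa> s b \<sigma> l x \<in> borel_measurable borel"
  unfolding wquad_def[abs_def] wlin_def[abs_def] by measurable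

context
  fixes \<kappa> s b \<sigma> :: real
  assumes \<kappa>: "\<kappa> > 0" and s: "s > 0" and \<sigma>: "\<bar>\<sigma>\<bar> = 1"
begin


lemma zvar_wvar_neq_0: "zvar l \<noteq> 0" "wvar \<kappa> s l \<noteq> 0"
  using s by (auto simp: zvar_def wvar_def complex_eq_iff)

lemma inverse_wquad: "inverse (wquad \<kappa> s l k) = zvar l * wvar \<kappa> s l / wden \<kappa> s l k"
proof -
  have "wquad \<kappa> s l k = wden \<kappa> s l k / (zvar l * wvar \<kappa> s l)"
    using zvar_wvar_neq_0[of l] by (simp add: wquad_def wden_def field_simps)
  then show ?thesis by simp
qed

lemma Re_wquad: "Re (wquad \<kappa> s l k) = s / (norm (wvar \<kappa> s l))\<^sup>2 + k\<^sup>2 / (norm (zvar l))\<^sup>2"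
  by (simp add: wquad_def wvar_def zvar_def cmod_power2 flip: of_real_power)

lemma Re_wquad_ge: "Re (wquad \<kappa> s l k) \<ge> s / (norm (wvar \<kappa> s l))\<^sup>2" "Re (wquad \<kappa> s l k) > 0"
  using s zvar_wvar_neq_0[of l] unfolding Re_wquad by (auto intro!: add_pos_nonneg)


text \<open>Each of the two summands of \<open>Re_wquad\<close> controls one of the two summands of
  \<open>wlin\<close>. The constant is uniform in \<open>l\<close> and \<open>k\<close>, as the
  hypothesis of \<open>half_line_bound\<close> requires.\<close>

lemma norm_wlin_le: "norm (wlin \<kappa> s b \<sigma> l x k) \<le> (wconst s b) * \<bar>x\<bar> * sqrt (Re (wquad \<kappa> s l k))"
proof -
  have "norm (of_real b / wvar \<kappa> s l - of_real (\<sigma> * k) / zvar l) \<le> \<bar>b\<bar> / norm (wvar \<kappa> s l) + \<bar>k\<bar> / norm (zvar l)"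
    using norm_triangle_ineq4[of "of_real b / wvar \<kappa> s l" "of_real (\<sigma> * k) / zvar l"] \<sigma>
    by (simp add: norm_divide norm_mult abs_mult)
  also have "\<dots> \<le> sqrt (2 * (b\<^sup>2 / s + 1) * Re (wquad \<kappa> s l k))"
  proof (rule real_le_rsqrt)
    let ?p = "\<bar>b\<bar> / norm (wvar \<kappa> s l)" and ?q = "\<bar>k\<bar> / norm (zvar l)"
    have aux: "X \<le> 2 * (u + v)" if "X \<le> 2 * (p + q)" "p \<le> u" "q \<le> v" for X p q u v :: real
      by (rule order_trans[OF that(1)]) (intro mult_left_mono add_mono that zero_le_numeral)
    have "(p + q)\<^sup>2 \<le> 2 * (p\<^sup>2 + q\<^sup>2)" for p q :: real
      using zero_le_power2[of "p - q"] by (simp add: power2_eq_square algebra_simps)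
    then have "(?p + ?q)\<^sup>2 \<le> 2 * (?p\<^sup>2 + ?q\<^sup>2)" .
    moreover have "?p\<^sup>2 \<le> (b\<^sup>2 / s + 1) * (s / (norm (wvar \<kappa> s l))\<^sup>2)"
    proof -
      have "?p\<^sup>2 = b\<^sup>2 / s * (s / (norm (wvar \<kappa> s l))\<^sup>2)"
        using s by (simp add: power_divide)
      also have "\<dots> \<le> (b\<^sup>2 / s + 1) * (s / (norm (wvar \<kappa> s l))\<^sup>2)"
        using s by (intro mult_right_mono) auto
      finally show ?thesis .
    qed
    moreover have "?q\<^sup>2 \<le> (b\<^sup>2 / s + 1) * (k\<^sup>2 / (norm (zvar l))\<^sup>2)"
    proof -
      have "?q\<^sup>2 = 1 * (k\<^sup>2 / (norm (zvar l))\<^sup>2)"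
        by (simp add: power_divide)
      also have "\<dots> \<le> (b\<^sup>2 / s + 1) * (k\<^sup>2 / (norm (zvar l))\<^sup>2)"
        using s by (intro mult_right_mono) auto
      finally show ?thesis .
    qed
    ultimately have "(?p + ?q)\<^sup>2 \<le> 2 * ((b\<^sup>2 / s + 1) * (s / (norm (wvar \<kappa> s l))\<^sup>2) + (b\<^sup>2 / s + 1) * (k\<^sup>2 / (norm (zvar l))\<^sup>2))"
      using aux by blast
    then show "(?p + ?q)\<^sup>2 \<le> 2 * (b\<^sup>2 / s + 1) * Re (wquad \<kappa> s l k)"
      by (simp only: Re_wquad distrib_left[symmetric] mult.assoc)
  qed
  also have "\<dots> = (wconst s b) * sqrt (Re (wquad \<kappa> s l k))"
    by (simp add: wconst_def real_sqrt_mult)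
  finally have "\<bar>x\<bar> * norm (of_real b / wvar \<kappa> s l - of_real (\<sigma> * k) / zvar l) \<le> \<bar>x\<bar> * ((wconst s b) * sqrt (Re (wquad \<kappa> s l k)))"
    by (rule mult_left_mono) auto
  then show ?thesis
    by (simp add: wlin_def norm_mult mult_ac)
qed

text \<open>The imaginary parts of \<open>zvar\<close> and \<open>wvar\<close> have opposite signs
  and cancel exactly at \<open>k = 1 / \<kappa>\<close>, the edge of the wedge. Near this edge
  \<open>wden\<close> stays bounded as \<open>l\<close> grows, elsewhere it is of size
  \<open>l\<close>.\<close>

lemma wden_eq: "wden \<kappa> s l k = Complex (1 + k\<^sup>2 * s) (- (l * (1 - \<kappa>\<^sup>2 * k\<^sup>2)))"
  by (simp add: wden_def zvar_def wvar_def complex_eq_iff algebra_simps flip: of_real_power)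

lemma wden_neq_0: "wden \<kappa> s l k \<noteq> 0"
proof -
  have "1 + k\<^sup>2 * s > 0" using s by (intro add_pos_nonneg) auto
  then show ?thesis by (auto simp: wden_eq complex_eq_iff)
qed

context
  fixes l k :: real
  assumes l: "l > 0" and k: "0 \<le> k" "k \<le> 1 / \<kappa>"
begin

lemma one_minus_square_bounds: "1 - \<kappa> * k \<le> 1 - \<kappa>\<^sup>2 * k\<^sup>2" "1 - \<kappa>\<^sup>2 * k\<^sup>2 \<le> 2 * (1 - \<kappa> * k)" "0 \<le> 1 - \<kappa> * k"
proof -
  have t: "0 \<le> \<kappa> * k" "\<kappa> * k \<le> 1" using k \<kappa> by (auto simp: field_simps)
  have eq: "1 - \<kappa>\<^sup>2 * k\<^sup>2 = (1 - \<kappa> * k) * (1 + \<kappa> * k)"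
    by (simp add: power2_eq_square algebra_simps)
  show "0 \<le> 1 - \<kappa> * k" using t by simp
  show "1 - \<kappa> * k \<le> 1 - \<kappa>\<^sup>2 * k\<^sup>2"
    unfolding eq using t mult_left_mono[of 1 "1 + \<kappa> * k" "1 - \<kappa> * k"] by simp
  show "1 - \<kappa>\<^sup>2 * k\<^sup>2 \<le> 2 * (1 - \<kappa> * k)"
    unfolding eq using t mult_left_mono[of "1 + \<kappa> * k" 2 "1 - \<kappa> * k"] by simp
qed

lemma norm_inverse_wden_le: "norm (1 / wden \<kappa> s l k) \<le> 2 / (1 + l * (1 - \<kappa> * k))"
proof -
  have pos: "1 + l * (1 - \<kappa> * k) > 0"
    using one_minus_square_bounds l by (intro add_pos_nonneg) auto
  have "1 + l * (1 - \<kappa> * k) \<le> \<bar>Re (wden \<kappa> s l k)\<bar> + \<bar>Im (wden \<kappa> s l k)\<bar>"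
  proof -
    have "l * (1 - \<kappa> * k) \<le> \<bar>l * (1 - \<kappa>\<^sup>2 * k\<^sup>2)\<bar>"
      using mult_left_mono[OF one_minus_square_bounds(1), of l] l by linarith
    moreover have "1 \<le> \<bar>1 + k\<^sup>2 * s\<bar>" using s by simp
    ultimately show ?thesis by (simp add: wden_eq)
  qed
  also have "\<dots> \<le> 2 * norm (wden \<kappa> s l k)"
    using abs_Re_le_cmod[of "wden \<kappa> s l k"] abs_Im_le_cmod[of "wden \<kappa> s l k"] by simp
  finally have "1 + l * (1 - \<kappa> * k) \<le> 2 * norm (wden \<kappa> s l k)" .
  then show ?thesis
    using pos wden_neq_0[of l k] by (simp add: norm_divide field_simps)
qed

text \<open>The imaginary part of the reciprocal is the one that carries the logarithm, and it is
  nonnegative on the whole range of \<open>k\<close>, so that nothing cancels in the integral. The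
  denominator bounds \<open>(norm wden)\<^sup>2\<close> from above through
  \<open>k \<le> 1 / \<kappa>\<close>.\<close>

lemma Im_inverse_wden_ge:
  "Im (1 / wden \<kappa> s l k) \<ge> l * (1 - \<kappa> * k) / ((1 + s / \<kappa>\<^sup>2)\<^sup>2 + 4 * l\<^sup>2 * (1 - \<kappa> * k)\<^sup>2)"
proof -
  let ?t = "1 - \<kappa> * k" and ?B = "l * (1 - \<kappa>\<^sup>2 * k\<^sup>2)" and ?A = "1 + k\<^sup>2 * s"
  have B: "l * ?t \<le> ?B" "?B \<le> 2 * l * ?t" "0 \<le> l * ?t"
    using mult_left_mono[OF one_minus_square_bounds(1), of l] mult_left_mono[OF one_minus_square_bounds(2), of l] one_minus_square_bounds(3) l by auto
  have "k\<^sup>2 \<le> (1 / \<kappa>)\<^sup>2" using k by (intro power_mono) auto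
  then have "k\<^sup>2 * s \<le> (1 / \<kappa>)\<^sup>2 * s"
    using s by (intro mult_right_mono) auto
  then have A: "?A \<le> 1 + s / \<kappa>\<^sup>2" "0 < ?A"
    using s by (auto simp: power_divide intro!: add_pos_nonneg)
  have "?A\<^sup>2 + ?B\<^sup>2 \<le> (1 + s / \<kappa>\<^sup>2)\<^sup>2 + (2 * l * ?t)\<^sup>2"
    using A B by (intro add_mono power_mono) auto
  then have "l * ?t / ((1 + s / \<kappa>\<^sup>2)\<^sup>2 + 4 * l\<^sup>2 * ?t\<^sup>2) \<le> ?B / (?A\<^sup>2 + ?B\<^sup>2)"
    using A B by (intro frac_le) (auto simp: power_mult_distrib intro!: add_pos_nonneg)
  also have "\<dots> = Im (1 / wden \<kappa> s l k)"
    by (simp add: wden_eq Im_divide)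
  finally show ?thesis .
qed

end

text \<open>The minorant of the imaginary part is, up to a constant, the derivative of the logarithm
  of its own denominator. The bound is of order \<open>ln l / l\<close>.\<close>

lemma integral_inverse_wden_ge:
  assumes l: "l > 0"
  shows "norm (LINT k:{0..1/\<kappa>}|lborel. 1 / wden \<kappa> s l k) \<ge>
    (ln ((1 + s / \<kappa>\<^sup>2)\<^sup>2 + 4 * l\<^sup>2) - ln ((1 + s / \<kappa>\<^sup>2)\<^sup>2)) / (8 * l * \<kappa>)"
proof -
  let ?A = "(1 + s / \<kappa>\<^sup>2)\<^sup>2"
  let ?f = "\<lambda>k. l * (1 - \<kappa> * k) / (?A + 4 * l\<^sup>2 * (1 - \<kappa> * k)\<^sup>2)"
  let ?g = "\<lambda>k. ?A + 4 * l\<^sup>2 * (1 - \<kappa> * k)\<^sup>2"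
  let ?F = "\<lambda>k. - 1 / (8 * l * \<kappa>) * ln (?g k)"
  have "1 + s / \<kappa>\<^sup>2 > 0" using s \<kappa> by (intro add_pos_pos) auto
  then have A: "?A > 0" by simp
  have pos: "?A + 4 * l\<^sup>2 * y\<^sup>2 > 0" for y using A by (intro add_pos_nonneg) auto
  have cont: "continuous_on S ?f" for S
    using pos by (intro continuous_intros) (metis less_irrefl)
  have "(LINT k:{0..1/\<kappa>}|lborel. ?f k) = ?F (1/\<kappa>) - ?F 0"
    unfolding set_lebesgue_integral_def
  proof (rule integral_FTC_atLeastAtMost)
    show "0 \<le> 1 / \<kappa>" using \<kappa> by simp
    fix k
    have "((\<lambda>k. ln (?g k)) has_field_derivative - (8 * l\<^sup>2 * \<kappa> * (1 - \<kappa> * k)) / ?g k) (at k within {0..1/\<kappa>})"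
      by (auto intro!: derivative_eq_intros pos)
    from DERIV_cmult[OF this, of "- 1 / (8 * l * \<kappa>)"]
    have "(?F has_field_derivative ?f k) (at k within {0..1/\<kappa>})"
      by (rule DERIV_cong) (use l \<kappa> in \<open>simp add: power2_eq_square[of l]\<close>)
    then show "(?F has_vector_derivative ?f k) (at k within {0..1/\<kappa>})"
      by (simp add: has_real_derivative_iff_has_vector_derivative)
  qed (rule cont)
  also have "\<dots> = (ln (?A + 4 * l\<^sup>2) - ln ?A) / (8 * l * \<kappa>)"
    using \<kappa> l by (simp add: field_simps)
  finally have 1: "(LINT k:{0..1/\<kappa>}|lborel. ?f k) = (ln (?A + 4 * l\<^sup>2) - ln ?A) / (8 * l * \<kappa>)" .
  have contD: "continuous_on S (\<lambda>k. 1 / wden \<kappa> s l k)" for S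
    using wden_neq_0 by (intro continuous_intros) (auto simp: wden_def intro!: continuous_intros)
  have iD: "set_integrable lborel {0..1/\<kappa>} (\<lambda>k. 1 / wden \<kappa> s l k)"
    by (rule borel_integrable_atLeastAtMost'[OF contD])
  have "(LINT k:{0..1/\<kappa>}|lborel. ?f k) \<le> (LINT k:{0..1/\<kappa>}|lborel. Im (1 / wden \<kappa> s l k))"
  proof (rule set_integral_mono)
    show "set_integrable lborel {0..1/\<kappa>} ?f"
      by (rule borel_integrable_atLeastAtMost'[OF cont])
    show "set_integrable lborel {0..1/\<kappa>} (\<lambda>k. Im (1 / wden \<kappa> s l k))"
      by (intro borel_integrable_atLeastAtMost' continuous_intros contD)
    show "?f k \<le> Im (1 / wden \<kappa> s l k)" if "k \<in> {0..1/\<kappa>}" for k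
      using Im_inverse_wden_ge[OF l, of k] that by simp
  qed
  also have "\<dots> = Im (LINT k:{0..1/\<kappa>}|lborel. 1 / wden \<kappa> s l k)"
    using integral_Im[OF iD[unfolded set_integrable_def]]
    by (simp add: set_lebesgue_integral_def)
  also have "\<dots> \<le> norm (LINT k:{0..1/\<kappa>}|lborel. 1 / wden \<kappa> s l k)"
    using abs_Im_le_cmod order_trans abs_ge_self by blast
  finally show ?thesis unfolding 1 .
qed

text \<open>Weighs the error caused by \<open>wlin\<close>: the majorant of \<open>1 / wden\<close>
  has an integral of the same order \<open>ln l / l\<close> as the main term.\<close>

lemma integral_majorant:
  assumes l: "l > 0"
  shows "set_integrable lborel {0..1/\<kappa>} (\<lambda>k. 2 / (1 + l * (1 - \<kappa> * k)))"
    and "(LINT k:{0..1/\<kappa>}|lborel. 2 / (1 + l * (1 - \<kappa> * k))) = 2 * ln (1 + l) / (l * \<kappa>)"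
proof -
  have pos: "1 + l * (1 - \<kappa> * k) > 0" if "k \<in> {0..1/\<kappa>}" for k
  proof -
    have "0 \<le> 1 - \<kappa> * k" using that \<kappa> by (auto simp: field_simps)
    then show ?thesis using l by (intro add_pos_nonneg) auto
  qed
  have cont: "continuous_on {0..1/\<kappa>} (\<lambda>k. 2 / (1 + l * (1 - \<kappa> * k)))"
    using pos by (intro continuous_intros) (metis less_irrefl)
  show "set_integrable lborel {0..1/\<kappa>} (\<lambda>k. 2 / (1 + l * (1 - \<kappa> * k)))"
    by (rule borel_integrable_atLeastAtMost'[OF cont])
  let ?F = "\<lambda>k. - 2 / (l * \<kappa>) * ln (1 + l * (1 - \<kappa> * k))"
  have "(LINT k:{0..1/\<kappa>}|lborel. 2 / (1 + l * (1 - \<kappa> * k))) = ?F (1/\<kappa>) - ?F 0"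
    unfolding set_lebesgue_integral_def
  proof (rule integral_FTC_atLeastAtMost)
    show "0 \<le> 1 / \<kappa>" using \<kappa> by simp
    fix k assume "0 \<le> k" "k \<le> 1 / \<kappa>"
    then have p: "1 + l * (1 - \<kappa> * k) > 0" using pos by simp
    have "((\<lambda>k. ln (1 + l * (1 - \<kappa> * k))) has_field_derivative - (l * \<kappa>) / (1 + l * (1 - \<kappa> * k))) (at k within {0..1/\<kappa>})"
      by (auto intro!: derivative_eq_intros p)
    from DERIV_cmult[OF this, of "- 2 / (l * \<kappa>)"]
    have "(?F has_field_derivative 2 / (1 + l * (1 - \<kappa> * k))) (at k within {0..1/\<kappa>})"
      by (rule DERIV_cong) (use l \<kappa> in simp)
    then show "(?F has_vector_derivative 2 / (1 + l * (1 - \<kappa> * k))) (at k within {0..1/\<kappa>})"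
      by (simp add: has_real_derivative_iff_has_vector_derivative)
  qed (rule cont)
  then show "(LINT k:{0..1/\<kappa>}|lborel. 2 / (1 + l * (1 - \<kappa> * k))) = 2 * ln (1 + l) / (l * \<kappa>)"
    using \<kappa> by simp
qed

text \<open>The linear term \<open>wlin\<close> contributes an error which is also of order \<open>ln l\<close>, but carries a factor \<open>\<bar>x\<bar>\<close>.\<close>

lemma wedge_integral_lower_bound:
  assumes l: "l > 0"
  shows "norm (LINT k:{0..1/\<kappa>}|lborel. LINT u:{0<..}|lborel. of_real u * gexp (wquad \<kappa> s l k) (wlin \<kappa> s b \<sigma> l x k) u) \<ge>
    norm (zvar l * wvar \<kappa> s l) / (l * \<kappa>) *
      ((ln ((1 + s / \<kappa>\<^sup>2)\<^sup>2 + 4 * l\<^sup>2) - ln ((1 + s / \<kappa>\<^sup>2)\<^sup>2)) / (16 * pi)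
       - 2 * sqrt 2 * (wconst s b) * \<bar>x\<bar> * exp (2 * pi * ((wconst s b) * \<bar>x\<bar>)\<^sup>2) * ln (1 + l))"
proof -
  define E where "E k = (LINT u:{0<..}|lborel. gexp (wquad \<kappa> s l k) (wlin \<kappa> s b \<sigma> l x k) u)" for k
  let ?J = "{0..1/\<kappa>}"
  let ?M = "sqrt 2 * (wconst s b) * \<bar>x\<bar> * exp (2 * pi * ((wconst s b) * \<bar>x\<bar>)\<^sup>2)"
  have CC: "wconst s b \<ge> 0" using s by (simp add: wconst_def)
  have E_meas[measurable]: "E \<in> borel_measurable borel"
    unfolding E_def[abs_def] set_lebesgue_integral_def by measurable
  have D_meas[measurable]: "wden \<kappa> s l \<in> borel_measurable borel"
    unfolding wden_def[abs_def] by measurable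
  \<comment> \<open>The factor \<open>sqrt (Re wquad)\<close> in the bound of \<open>wlin\<close>
    cancels against the width in the bound of \<open>E\<close>, so \<open>?M\<close> depends neither
    on \<open>k\<close> nor on \<open>l\<close>.\<close>
  have "norm (wlin \<kappa> s b \<sigma> l x k * E k) \<le> ?M" for k
  proof -
    have "norm (wlin \<kappa> s b \<sigma> l x k) * norm (E k) \<le> ((wconst s b) * \<bar>x\<bar> * sqrt (Re (wquad \<kappa> s l k))) * (exp (2 * pi * ((wconst s b) * \<bar>x\<bar>)\<^sup>2) * sqrt (2 / Re (wquad \<kappa> s l k)))"
      unfolding E_def by (intro mult_mono norm_wlin_le half_line_bound Re_wquad_ge) (use CC Re_wquad_ge(2)[of l k] in auto)
    also have "\<dots> = ?M"
      using Re_wquad_ge(2)[of l k] by (simp add: real_sqrt_divide)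
    finally show ?thesis by (simp add: norm_mult)
  qed
  then have LE: "norm (wlin \<kappa> s b \<sigma> l x k * E k / wden \<kappa> s l k) \<le> ?M * (2 / (1 + l * (1 - \<kappa> * k)))" if "k \<in> ?J" for k
    using mult_mono[OF _ norm_inverse_wden_le[OF l, of k], of "norm (wlin \<kappa> s b \<sigma> l x k * E k)" ?M] that CC
    by (simp add: norm_divide)
  have iM: "set_integrable lborel ?J (\<lambda>k. ?M * (2 / (1 + l * (1 - \<kappa> * k))))"
    using integral_majorant(1)[OF l] by (rule set_integrable_mult_right)
  have iLE: "set_integrable lborel ?J (\<lambda>k. wlin \<kappa> s b \<sigma> l x k * E k / wden \<kappa> s l k)"
    unfolding set_integrable_def
  proof (rule Bochner_Integration.integrable_bound[OF iM[unfolded set_integrable_def]])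
    have "norm (indicat_real ?J k *\<^sub>R (wlin \<kappa> s b \<sigma> l x k * E k / wden \<kappa> s l k)) \<le>
        norm (indicat_real ?J k *\<^sub>R (?M * (2 / (1 + l * (1 - \<kappa> * k)))))" for k
    proof (cases "k \<in> ?J")
      case True
      from order_trans[OF LE[OF True] abs_ge_self] show ?thesis
        using True by (simp only: indicator_simps scaleR_one real_norm_def)
    qed simp
    then show "AE k in lborel. norm (indicat_real ?J k *\<^sub>R (wlin \<kappa> s b \<sigma> l x k * E k / wden \<kappa> s l k)) \<le>
        norm (indicat_real ?J k *\<^sub>R (?M * (2 / (1 + l * (1 - \<kappa> * k)))))"
      by (intro AE_I2)
  qed measurable
  have err: "norm (LINT k:?J|lborel. wlin \<kappa> s b \<sigma> l x k * E k / wden \<kappa> s l k) \<le> ?M * (2 * ln (1 + l) / (l * \<kappa>))"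
  proof -
    have "norm (LINT k:?J|lborel. wlin \<kappa> s b \<sigma> l x k * E k / wden \<kappa> s l k) \<le> (LINT k:?J|lborel. ?M * (2 / (1 + l * (1 - \<kappa> * k))))"
      unfolding set_lebesgue_integral_def
      by (rule Bochner_Integration.integral_norm_bound_integral[OF iLE[unfolded set_integrable_def] iM[unfolded set_integrable_def]])
        (use LE in \<open>auto simp: indicator_def\<close>)
    also have "\<dots> = ?M * (2 * ln (1 + l) / (l * \<kappa>))"
      by (simp only: set_integral_mult_right integral_majorant(2)[OF l])
    finally show ?thesis .
  qed
  have contD: "continuous_on S (\<lambda>k. 1 / wden \<kappa> s l k)" for S
    using wden_neq_0 by (intro continuous_intros) (auto simp: wden_def intro!: continuous_intros)
  have iD: "set_integrable lborel ?J (\<lambda>k. 1 / wden \<kappa> s l k)"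
    by (rule borel_integrable_atLeastAtMost'[OF contD])
  have "(LINT u:{0<..}|lborel. of_real u * gexp (wquad \<kappa> s l k) (wlin \<kappa> s b \<sigma> l x k) u) =
      zvar l * wvar \<kappa> s l / (2 * of_real pi) * (1 / wden \<kappa> s l k) + zvar l * wvar \<kappa> s l * (wlin \<kappa> s b \<sigma> l x k * E k / wden \<kappa> s l k)" for k
  proof -
    have "1 / (2 * p * Q) + L / Q * e = A / (2 * p) * (1 / D) + A * (L * e / D)"
      if "inverse Q = A / D" for p Q L e A D :: complex
      unfolding divide_inverse inverse_mult_distrib that[unfolded divide_inverse]
      by (simp only: mult_1_left mult_ac)
    from this[OF inverse_wquad, of "of_real pi" l k "wlin \<kappa> s b \<sigma> l x k" "E k"] show ?thesis
      unfolding half_line_moment[OF Re_wquad_ge(2)] E_def[symmetric] .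
  qed
  then have "(LINT k:?J|lborel. LINT u:{0<..}|lborel. of_real u * gexp (wquad \<kappa> s l k) (wlin \<kappa> s b \<sigma> l x k) u) =
      zvar l * wvar \<kappa> s l / (2 * of_real pi) * (LINT k:?J|lborel. 1 / wden \<kappa> s l k) +
      zvar l * wvar \<kappa> s l * (LINT k:?J|lborel. wlin \<kappa> s b \<sigma> l x k * E k / wden \<kappa> s l k)"
    using iD iLE by (simp only: set_integral_add set_integrable_mult_right set_integral_mult_right)
  also have "\<dots> = zvar l * wvar \<kappa> s l * ((LINT k:?J|lborel. 1 / wden \<kappa> s l k) / (2 * of_real pi) + (LINT k:?J|lborel. wlin \<kappa> s b \<sigma> l x k * E k / wden \<kappa> s l k))"
    by (simp add: algebra_simps)
  finally have eq: "(LINT k:?J|lborel. LINT u:{0<..}|lborel. of_real u * gexp (wquad \<kappa> s l k) (wlin \<kappa> s b \<sigma> l x k) u) = \<dots>" .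
  have "(ln ((1 + s / \<kappa>\<^sup>2)\<^sup>2 + 4 * l\<^sup>2) - ln ((1 + s / \<kappa>\<^sup>2)\<^sup>2)) / (8 * l * \<kappa>) / (2 * pi) - ?M * (2 * ln (1 + l) / (l * \<kappa>))
    \<le> norm (LINT k:?J|lborel. 1 / wden \<kappa> s l k) / (2 * pi) - norm (LINT k:?J|lborel. wlin \<kappa> s b \<sigma> l x k * E k / wden \<kappa> s l k)"
    using integral_inverse_wden_ge[OF l] err by (intro diff_mono divide_right_mono) auto
  also have "\<dots> \<le> norm ((LINT k:?J|lborel. 1 / wden \<kappa> s l k) / (2 * of_real pi) + (LINT k:?J|lborel. wlin \<kappa> s b \<sigma> l x k * E k / wden \<kappa> s l k))"
    using norm_diff_ineq[of "(LINT k:?J|lborel. 1 / wden \<kappa> s l k) / (2 * of_real pi)"] by (simp add: norm_divide)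
  finally have "norm (zvar l * wvar \<kappa> s l) * ((ln ((1 + s / \<kappa>\<^sup>2)\<^sup>2 + 4 * l\<^sup>2) - ln ((1 + s / \<kappa>\<^sup>2)\<^sup>2)) / (8 * l * \<kappa>) / (2 * pi) - ?M * (2 * ln (1 + l) / (l * \<kappa>)))
    \<le> norm (LINT k:?J|lborel. LINT u:{0<..}|lborel. of_real u * gexp (wquad \<kappa> s l k) (wlin \<kappa> s b \<sigma> l x k) u)"
    unfolding eq norm_mult[of "zvar l * wvar \<kappa> s l"] by (rule mult_left_mono) auto
  note lower = this
  have arrange: "N * (X / (8 * l * \<kappa>) / (2 * pi) - M * (2 * G / (l * \<kappa>))) = N / (l * \<kappa>) * (X / (16 * pi) - 2 * M * G)" for N X M G
    using l \<kappa> by (simp add: field_simps)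
  show ?thesis
    using lower unfolding arrange by (simp only: mult.assoc)
qed

text \<open>The order of choices is essential: \<open>d\<close> makes the error at most half of the
  leading logarithm, and only then is \<open>l\<close> taken large for a given \<open>R\<close>. The
  square root on the left is the normalisation by which the reduction to the wedge divides, and
  \<open>\<bar>x\<bar> \<le> 1\<close> will control the Gaussian factor in \<open>x\<close>.\<close>

lemma wedge_integral_unbounded:
  "\<exists>d>0. \<forall>R. \<exists>l>0. \<forall>x. \<bar>x\<bar> \<le> d \<longrightarrow> \<bar>x\<bar> \<le> 1 \<and>
    R * sqrt (norm (zvar l * wvar \<kappa> s l)) \<le>
      norm (LINT k:{0..1/\<kappa>}|lborel. LINT u:{0<..}|lborel. of_real u * gexp (wquad \<kappa> s l k) (wlin \<kappa> s b \<sigma> l x k) u)"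
proof -
  define A where "A = (1 + s / \<kappa>\<^sup>2)\<^sup>2"
  define G where "G = 2 * sqrt 2 * (wconst s b) * exp (2 * pi * (wconst s b)\<^sup>2)"
  \<comment> \<open>With \<open>G * d \<le> 1 / (16 * pi)\<close> the error takes one of the two
    copies of \<open>ln (1 + l) / (16 * pi)\<close> in the main term; \<open>G + 1\<close> keeps the
    denominator positive.\<close>
  define d where "d = min 1 (1 / (16 * pi * (G + 1)))"
  have CC: "wconst s b \<ge> 0" using s by (simp add: wconst_def)
  then have G: "G \<ge> 0" by (simp add: G_def)
  have "1 + s / \<kappa>\<^sup>2 > 0" using s \<kappa> by (intro add_pos_pos) auto
  then have A: "A > 0" by (simp add: A_def)
  have d: "d > 0" "d \<le> 1" using G by (auto simp: d_def intro!: divide_pos_pos)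
  have Gd: "G * d \<le> 1 / (16 * pi)"
  proof -
    have "G * d \<le> G * (1 / (16 * pi * (G + 1)))"
      using G by (intro mult_left_mono) (auto simp: d_def)
    also have "\<dots> = G / (G + 1) * (1 / (16 * pi))"
      by simp
    also have "\<dots> \<le> 1 * (1 / (16 * pi))"
      using G by (intro mult_right_mono) auto
    also have "\<dots> = 1 / (16 * pi)"
      by simp
    finally show ?thesis .
  qed
  have "\<exists>l>0. \<forall>x. \<bar>x\<bar> \<le> d \<longrightarrow> R * sqrt (norm (zvar l * wvar \<kappa> s l)) \<le>
      norm (LINT k:{0..1/\<kappa>}|lborel. LINT u:{0<..}|lborel. of_real u * gexp (wquad \<kappa> s l k) (wlin \<kappa> s b \<sigma> l x k) u)" for R
  proof (intro exI conjI allI impI)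
    \<comment> \<open>\<open>l \<ge> 1\<close> gives \<open>1 + l \<le> 2 * l\<close>; the
      exponential makes \<open>ln (1 + l) - ln A\<close>, which remains after the error is
      subtracted, at least \<open>16 * pi * \<bar>R\<bar>\<close>.\<close>
    define l where "l = max 1 (exp (ln A + 16 * pi * \<bar>R\<bar>))"
    show l: "l > 0" by (simp add: l_def)
    have l1: "l \<ge> 1" by (simp add: l_def)
    have "ln (1 + l) \<ge> ln (exp (ln A + 16 * pi * \<bar>R\<bar>))"
      by (subst ln_le_cancel_iff) (auto simp: l_def)
    then have big: "ln (1 + l) \<ge> ln A + 16 * pi * \<bar>R\<bar>" by simp
    fix x assume x: "\<bar>x\<bar> \<le> d"
    let ?N = "norm (zvar l * wvar \<kappa> s l)"
    have "((wconst s b) * \<bar>x\<bar>)\<^sup>2 \<le> (wconst s b)\<^sup>2"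
      using CC x d by (intro power_mono) (auto intro: mult_left_le)
    then have "2 * sqrt 2 * (wconst s b) * \<bar>x\<bar> * exp (2 * pi * ((wconst s b) * \<bar>x\<bar>)\<^sup>2) \<le> 2 * sqrt 2 * (wconst s b) * \<bar>x\<bar> * exp (2 * pi * (wconst s b)\<^sup>2)"
      using CC by (intro mult_left_mono) auto
    also have "\<dots> = G * \<bar>x\<bar>" by (simp add: G_def)
    also have "\<dots> \<le> G * d" using x G by (intro mult_left_mono) auto
    also note Gd
    finally have "2 * sqrt 2 * (wconst s b) * \<bar>x\<bar> * exp (2 * pi * ((wconst s b) * \<bar>x\<bar>)\<^sup>2) * ln (1 + l) \<le> 1 / (16 * pi) * ln (1 + l)"
      using l by (intro mult_right_mono) auto
    moreover have "ln (A + 4 * l\<^sup>2) \<ge> 2 * ln (1 + l)"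
    proof -
      have "(1 + l)\<^sup>2 \<le> (2 * l)\<^sup>2" using l1 by (intro power_mono) auto
      then have "ln ((1 + l)\<^sup>2) \<le> ln (A + 4 * l\<^sup>2)"
        using A l by (subst ln_le_cancel_iff) (auto simp: power_mult_distrib intro!: add_pos_nonneg)
      then show ?thesis using l by (simp add: ln_realpow)
    qed
    ultimately have br: "\<bar>R\<bar> \<le> (ln (A + 4 * l\<^sup>2) - ln A) / (16 * pi)
       - 2 * sqrt 2 * (wconst s b) * \<bar>x\<bar> * exp (2 * pi * ((wconst s b) * \<bar>x\<bar>)\<^sup>2) * ln (1 + l)" (is "_ \<le> ?br")
    proof -
      assume a: "2 * sqrt 2 * (wconst s b) * \<bar>x\<bar> * exp (2 * pi * ((wconst s b) * \<bar>x\<bar>)\<^sup>2) * ln (1 + l) \<le> 1 / (16 * pi) * ln (1 + l)"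
        and b: "2 * ln (1 + l) \<le> ln (A + 4 * l\<^sup>2)"
      have "\<bar>R\<bar> = (16 * pi * \<bar>R\<bar>) / (16 * pi)" by simp
      also have "\<dots> \<le> (ln (A + 4 * l\<^sup>2) - ln A - ln (1 + l)) / (16 * pi)"
        using b big by (intro divide_right_mono) auto
      also have "\<dots> = (ln (A + 4 * l\<^sup>2) - ln A) / (16 * pi) - 1 / (16 * pi) * ln (1 + l)"
        by (simp add: diff_divide_distrib)
      also have "\<dots> \<le> ?br" using a by simp
      finally show ?thesis .
    qed
    \<comment> \<open>Hence \<open>?N / (l * \<kappa>)\<close> dominates \<open>sqrt ?N\<close>: the
      logarithm survives the division by the normalisation.\<close>
    have "(\<kappa> * l)\<^sup>2 \<le> ?N"
    proof -
      have "l \<le> norm (zvar l)" using abs_Im_le_cmod[of "zvar l"] by (simp add: zvar_def)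
      moreover have "\<kappa>\<^sup>2 * l \<le> norm (wvar \<kappa> s l)" using abs_Im_le_cmod[of "wvar \<kappa> s l"] by (simp add: wvar_def)
      ultimately have "l * (\<kappa>\<^sup>2 * l) \<le> norm (zvar l) * norm (wvar \<kappa> s l)"
        using l by (intro mult_mono) auto
      then show ?thesis by (simp add: norm_mult power2_eq_square mult_ac)
    qed
    then have "\<kappa> * l \<le> sqrt ?N" by (rule real_le_rsqrt)
    then have "sqrt ?N * (\<kappa> * l) \<le> sqrt ?N * sqrt ?N" by (intro mult_left_mono) auto
    then have "sqrt ?N \<le> ?N / (l * \<kappa>)"
      using l \<kappa> by (simp add: field_simps)
    then have "sqrt ?N * \<bar>R\<bar> \<le> ?N / (l * \<kappa>) * ?br"
      using br l \<kappa> by (intro mult_mono) auto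
    also note wedge_integral_lower_bound[OF l, of x, folded A_def]
    finally show "R * sqrt ?N \<le>
      norm (LINT k:{0..1/\<kappa>}|lborel. LINT u:{0<..}|lborel. of_real u * gexp (wquad \<kappa> s l k) (wlin \<kappa> s b \<sigma> l x k) u)"
      using mult_right_mono[OF abs_ge_self[of R], of "sqrt ?N"] by (simp add: mult.commute)
  qed
  with d show ?thesis by (intro exI[of _ d]) fastforce
qed

end

section \<open>The planar wedge in polar-like coordinates\<close>

text \<open>The side of the cut in \<open>\<xi> n\<close> on which \<open>u + \<alpha> * v > 0\<close> confines \<open>v\<close> to an interval of length \<open>u / \<bar>\<alpha>\<bar>\<close>, so
  that the imaginary part of \<open>wden\<close> does not change sign; on the other side there would be cancellation.\<close>

definition wedge_side :: "real \<Rightarrow> real set" where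
  "wedge_side \<alpha> = (if \<alpha> > 0 then {v. v < 0} else {v. v \<ge> 0})"

lemma wedge_side_measurable [measurable]: "wedge_side \<alpha> \<in> sets borel"
  by (simp add: wedge_side_def)

context
  fixes \<alpha> s b l x :: real
  assumes \<alpha>: "\<alpha> \<noteq> 0" and s: "s > 0"
begin


lemma gexp_wedge: "gexp (inverse (zvar l)) (\<i> * of_real x / zvar l) (- (sgn \<alpha> * u * k)) * gexp (inverse (wvar \<bar>\<alpha>\<bar> s l)) (\<i> * of_real (x * b) / wvar \<bar>\<alpha>\<bar> s l) u = gexp (wquad \<bar>\<alpha>\<bar> s l k) (wlin \<bar>\<alpha>\<bar> s b (sgn \<alpha>) l x k) u"
proof -
  have sq: "(complex_of_real (sgn \<alpha>))\<^sup>2 = 1"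
    using \<alpha> by (simp add: sgn_if)
  show ?thesis
    unfolding gexp_def exp_add[symmetric]
    by (intro arg_cong[of _ _ exp])
      (simp add: wquad_def wlin_def power_mult_distrib sq algebra_simps divide_inverse)
qed

text \<open>Majorant for Fubini, independent of \<open>k\<close>: \<open>Re wquad\<close> is at
  least its value at \<open>k = 0\<close>, and \<open>c\<close> bounds the linear coefficient on the
  compact range of \<open>k\<close>.\<close>

lemma gexp_wedge_bound:
  obtains c where "c \<ge> 0"
    "\<And>k u. k \<in> {0..1/\<bar>\<alpha>\<bar>} \<Longrightarrow> u > 0 \<Longrightarrow> norm (of_real u * gexp (wquad \<bar>\<alpha>\<bar> s l k) (wlin \<bar>\<alpha>\<bar> s b (sgn \<alpha>) l x k) u) \<le> \<bar>u\<bar> * norm (gexp (of_real (s / (norm (wvar \<bar>\<alpha>\<bar> s l))\<^sup>2)) (of_real c) u)"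
proof
  let ?c = "\<bar>x\<bar> * (\<bar>b\<bar> / norm (wvar \<bar>\<alpha>\<bar> s l) + 1 / \<bar>\<alpha>\<bar> / norm (zvar l))"
  show "?c \<ge> 0" by simp
  fix k u :: real assume k: "k \<in> {0..1/\<bar>\<alpha>\<bar>}" and u: "u > 0"
  have "Re (wlin \<bar>\<alpha>\<bar> s b (sgn \<alpha>) l x k) \<le> norm (wlin \<bar>\<alpha>\<bar> s b (sgn \<alpha>) l x k)" by (rule complex_Re_le_cmod)
  also have "\<dots> \<le> ?c"
    unfolding wlin_def norm_mult
  proof -
    have "norm (of_real b / wvar \<bar>\<alpha>\<bar> s l - of_real (sgn \<alpha> * k) / zvar l) \<le> \<bar>b\<bar> / norm (wvar \<bar>\<alpha>\<bar> s l) + \<bar>k\<bar> / norm (zvar l)"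
      using norm_triangle_ineq4[of "of_real b / wvar \<bar>\<alpha>\<bar> s l" "of_real (sgn \<alpha> * k) / zvar l"] \<alpha>
      by (simp add: norm_divide norm_mult abs_mult abs_sgn_eq)
    also have "\<dots> \<le> \<bar>b\<bar> / norm (wvar \<bar>\<alpha>\<bar> s l) + 1 / \<bar>\<alpha>\<bar> / norm (zvar l)"
      using k by (intro add_left_mono divide_right_mono) auto
    finally have "\<bar>x\<bar> * norm (of_real b / wvar \<bar>\<alpha>\<bar> s l - of_real (sgn \<alpha> * k) / zvar l) \<le> ?c"
      by (rule mult_left_mono) auto
    then show "norm \<i> * norm (complex_of_real x) * norm (of_real b / wvar \<bar>\<alpha>\<bar> s l - of_real (sgn \<alpha> * k) / zvar l) \<le> ?c"
      by simp
  qed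
  finally have "2 * pi * Re (wlin \<bar>\<alpha>\<bar> s b (sgn \<alpha>) l x k) * u \<le> 2 * pi * ?c * u"
    using u by (intro mult_right_mono mult_left_mono) auto
  moreover have "pi * (s / (norm (wvar \<bar>\<alpha>\<bar> s l))\<^sup>2) * u\<^sup>2 \<le> pi * Re (wquad \<bar>\<alpha>\<bar> s l k) * u\<^sup>2"
    using Re_wquad_ge(1)[of "\<bar>\<alpha>\<bar>" s "sgn \<alpha>" l k] \<alpha> s by (intro mult_right_mono mult_left_mono) auto
  ultimately have "- (pi * Re (wquad \<bar>\<alpha>\<bar> s l k) * u\<^sup>2) + 2 * pi * Re (wlin \<bar>\<alpha>\<bar> s b (sgn \<alpha>) l x k) * u \<le> - (pi * (s / (norm (wvar \<bar>\<alpha>\<bar> s l))\<^sup>2) * u\<^sup>2) + 2 * pi * ?c * u"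
    by linarith
  then have "norm (gexp (wquad \<bar>\<alpha>\<bar> s l k) (wlin \<bar>\<alpha>\<bar> s b (sgn \<alpha>) l x k) u) \<le> norm (gexp (of_real (s / (norm (wvar \<bar>\<alpha>\<bar> s l))\<^sup>2)) (of_real ?c) u)"
    unfolding norm_gexp by simp
  then have "\<bar>u\<bar> * norm (gexp (wquad \<bar>\<alpha>\<bar> s l k) (wlin \<bar>\<alpha>\<bar> s b (sgn \<alpha>) l x k) u) \<le> \<bar>u\<bar> * norm (gexp (of_real (s / (norm (wvar \<bar>\<alpha>\<bar> s l))\<^sup>2)) (of_real ?c) u)"
    by (rule mult_left_mono) auto
  then show "norm (of_real u * gexp (wquad \<bar>\<alpha>\<bar> s l k) (wlin \<bar>\<alpha>\<bar> s b (sgn \<alpha>) l x k) u) \<le> \<bar>u\<bar> * norm (gexp (of_real (s / (norm (wvar \<bar>\<alpha>\<bar> s l))\<^sup>2)) (of_real ?c) u)"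
    by (simp add: norm_mult)
qed

text \<open>Substitution \<open>v = - sgn \<alpha> * u * k\<close>.\<close>

lemma wedge_inner:
  "(LINT v|lborel. indicator {v. u + \<alpha> * v > 0 \<and> v \<in> wedge_side \<alpha>} v *\<^sub>R gexp (inverse (zvar l)) (\<i> * of_real x / zvar l) v) * gexp (inverse (wvar \<bar>\<alpha>\<bar> s l)) (\<i> * of_real (x * b) / wvar \<bar>\<alpha>\<bar> s l) u =
    indicator {0<..} u *\<^sub>R (LINT k|lborel. indicator {0..1/\<bar>\<alpha>\<bar>} k *\<^sub>R (of_real u * gexp (wquad \<bar>\<alpha>\<bar> s l k) (wlin \<bar>\<alpha>\<bar> s b (sgn \<alpha>) l x k) u))"
proof (cases "u > 0")
  case False
  \<comment> \<open>On the chosen side \<open>\<alpha> * v \<le> 0\<close>, so the wedge lies over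
    \<open>u > 0\<close>.\<close>
  have "{v. u + \<alpha> * v > 0 \<and> v \<in> wedge_side \<alpha>} = {}"
  proof -
    have "\<alpha> * v \<le> 0" if "v \<in> wedge_side \<alpha>" for v
      using that \<alpha> by (auto simp: wedge_side_def mult_le_0_iff split: if_splits)
    then show ?thesis using False by force
  qed
  then show ?thesis using False by simp
next
  case True
  have su: "- (sgn \<alpha>) * u \<noteq> 0" using True \<alpha> by (simp add: sgn_if)
  have abs_su: "\<bar>- (sgn \<alpha>) * u\<bar> = u" using True \<alpha> by (simp add: abs_mult)
  have ind: "AE k in lborel. indicator {v. u + \<alpha> * v > 0 \<and> v \<in> wedge_side \<alpha>} (0 + (- (sgn \<alpha>) * u) * k) *\<^sub>R gexp (inverse (zvar l)) (\<i> * of_real x / zvar l) (0 + (- (sgn \<alpha>) * u) * k) =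
      indicator {0..1/\<bar>\<alpha>\<bar>} k *\<^sub>R gexp (inverse (zvar l)) (\<i> * of_real x / zvar l) (- (sgn \<alpha> * u * k))"
  proof -
    \<comment> \<open>The wedge is open along its edge, and its side contains \<open>v = 0\<close>
      or not according to the sign of \<open>\<alpha>\<close>. Dropping both endpoints as a null set
      gives the same closed interval in all cases.\<close>
    have "AE k in lborel. k \<noteq> 0 \<and> k \<noteq> 1 / \<bar>\<alpha>\<bar>"
      using AE_lborel_singleton[of 0] AE_lborel_singleton[of "1/\<bar>\<alpha>\<bar>"] by eventually_elim auto
    then show ?thesis
    proof eventually_elim
      case (elim k)
      have e: "u + \<alpha> * (0 + (- (sgn \<alpha>) * u) * k) = u * (1 - \<bar>\<alpha>\<bar> * k)"
        by (cases "\<alpha> > 0") (auto simp: sgn_if algebra_simps)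
      have 1: "u + \<alpha> * (0 + (- (sgn \<alpha>) * u) * k) > 0 \<longleftrightarrow> k < 1 / \<bar>\<alpha>\<bar>"
        unfolding e using True \<alpha> by (simp add: zero_less_mult_iff pos_less_divide_eq mult.commute)
      have 2: "0 + (- (sgn \<alpha>) * u) * k \<in> wedge_side \<alpha> \<longleftrightarrow> 0 \<le> k"
        using True elim \<alpha> by (auto simp: wedge_side_def sgn_if zero_less_mult_iff zero_le_mult_iff mult_less_0_iff)
      show ?case using 1 2 elim by (auto simp: indicator_def)
    qed
  qed
  have "(LINT v|lborel. indicator {v. u + \<alpha> * v > 0 \<and> v \<in> wedge_side \<alpha>} v *\<^sub>R gexp (inverse (zvar l)) (\<i> * of_real x / zvar l) v) =
     u *\<^sub>R (LINT k|lborel. indicator {v. u + \<alpha> * v > 0 \<and> v \<in> wedge_side \<alpha>} (0 + (- (sgn \<alpha>) * u) * k) *\<^sub>R gexp (inverse (zvar l)) (\<i> * of_real x / zvar l) (0 + (- (sgn \<alpha>) * u) * k))"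
    using lborel_integral_real_affine[OF su, of "\<lambda>v. indicator {v. u + \<alpha> * v > 0 \<and> v \<in> wedge_side \<alpha>} v *\<^sub>R gexp (inverse (zvar l)) (\<i> * of_real x / zvar l) v" 0]
    unfolding abs_su .
  also have "(LINT k|lborel. indicator {v. u + \<alpha> * v > 0 \<and> v \<in> wedge_side \<alpha>} (0 + (- (sgn \<alpha>) * u) * k) *\<^sub>R gexp (inverse (zvar l)) (\<i> * of_real x / zvar l) (0 + (- (sgn \<alpha>) * u) * k)) =
     (LINT k|lborel. indicator {0..1/\<bar>\<alpha>\<bar>} k *\<^sub>R gexp (inverse (zvar l)) (\<i> * of_real x / zvar l) (- (sgn \<alpha> * u * k)))"
    by (rule integral_cong_AE[OF _ _ ind]) measurable
  finally have "(LINT v|lborel. indicator {v. u + \<alpha> * v > 0 \<and> v \<in> wedge_side \<alpha>} v *\<^sub>R gexp (inverse (zvar l)) (\<i> * of_real x / zvar l) v) * gexp (inverse (wvar \<bar>\<alpha>\<bar> s l)) (\<i> * of_real (x * b) / wvar \<bar>\<alpha>\<bar> s l) u =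
    of_real u * ((LINT k|lborel. indicator {0..1/\<bar>\<alpha>\<bar>} k *\<^sub>R gexp (inverse (zvar l)) (\<i> * of_real x / zvar l) (- (sgn \<alpha> * u * k))) * gexp (inverse (wvar \<bar>\<alpha>\<bar> s l)) (\<i> * of_real (x * b) / wvar \<bar>\<alpha>\<bar> s l) u)"
    by (simp add: scaleR_conv_of_real mult.assoc)
  also have "\<dots> = (LINT k|lborel. of_real u * ((indicator {0..1/\<bar>\<alpha>\<bar>} k *\<^sub>R gexp (inverse (zvar l)) (\<i> * of_real x / zvar l) (- (sgn \<alpha> * u * k))) * gexp (inverse (wvar \<bar>\<alpha>\<bar> s l)) (\<i> * of_real (x * b) / wvar \<bar>\<alpha>\<bar> s l) u))"
    by (simp only: integral_mult_left_zero integral_mult_right_zero)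
  also have "\<dots> = (LINT k|lborel. indicator {0..1/\<bar>\<alpha>\<bar>} k *\<^sub>R (of_real u * gexp (wquad \<bar>\<alpha>\<bar> s l k) (wlin \<bar>\<alpha>\<bar> s b (sgn \<alpha>) l x k) u))"
    unfolding gexp_wedge[symmetric]
    by (intro Bochner_Integration.integral_cong refl) (simp only: mult_scaleR_left mult_scaleR_right)
  finally show ?thesis using True by simp
qed

lemma wedge_integral_eq:
  "(LINT u|lborel. (LINT v|lborel. indicator {v. u + \<alpha> * v > 0 \<and> v \<in> wedge_side \<alpha>} v *\<^sub>R gexp (inverse (zvar l)) (\<i> * of_real x / zvar l) v) * gexp (inverse (wvar \<bar>\<alpha>\<bar> s l)) (\<i> * of_real (x * b) / wvar \<bar>\<alpha>\<bar> s l) u) =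
    (LINT k:{0..1/\<bar>\<alpha>\<bar>}|lborel. LINT u:{0<..}|lborel. of_real u * gexp (wquad \<bar>\<alpha>\<bar> s l k) (wlin \<bar>\<alpha>\<bar> s b (sgn \<alpha>) l x k) u)"
proof -
  let ?J = "{0..1/\<bar>\<alpha>\<bar>}"
  let ?f = "\<lambda>u k. indicator {0<..} u *\<^sub>R (indicator ?J k *\<^sub>R (of_real u * gexp (wquad \<bar>\<alpha>\<bar> s l k) (wlin \<bar>\<alpha>\<bar> s b (sgn \<alpha>) l x k) u))"
  obtain c where c: "c \<ge> 0"
    "\<And>k u. k \<in> ?J \<Longrightarrow> u > 0 \<Longrightarrow> norm (of_real u * gexp (wquad \<bar>\<alpha>\<bar> s l k) (wlin \<bar>\<alpha>\<bar> s b (sgn \<alpha>) l x k) u) \<le> \<bar>u\<bar> * norm (gexp (of_real (s / (norm (wvar \<bar>\<alpha>\<bar> s l))\<^sup>2)) (of_real c) u)"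
    using gexp_wedge_bound by blast
  let ?H = "\<lambda>u. \<bar>u\<bar> * norm (gexp (of_real (s / (norm (wvar \<bar>\<alpha>\<bar> s l))\<^sup>2)) (of_real c) u)"
  have R0: "s / (norm (wvar \<bar>\<alpha>\<bar> s l))\<^sup>2 > 0"
    using zvar_wvar_neq_0(2)[of "\<bar>\<alpha>\<bar>" s "sgn \<alpha>" l] \<alpha> s by (simp add: sgn_if)
  have H: "integrable lborel ?H"
    using integrable_norm[OF integrable_power_gexp[of "of_real (s / (norm (wvar \<bar>\<alpha>\<bar> s l))\<^sup>2)" 1 "of_real c"]] R0
    by (simp add: norm_mult)
  have int: "integrable (lborel \<Otimes>\<^sub>M lborel) (case_prod ?f)"
  proof (rule Bochner_Integration.integrable_bound)
    show "integrable (lborel \<Otimes>\<^sub>M lborel) (\<lambda>(u, k). indicator ?J k *\<^sub>R ?H u)"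
    proof (rule lborel_pair.Fubini_integrable)
      have "(LINT k|lborel. norm (indicat_real ?J k *\<^sub>R ?H u)) = measure lborel ?J * ?H u" for u
      proof -
        have "(LINT k|lborel. norm (indicat_real ?J k *\<^sub>R ?H u)) = (LINT k|lborel. indicat_real ?J k * ?H u)"
          by (intro Bochner_Integration.integral_cong refl) (auto simp: indicator_def)
        also have "\<dots> = measure lborel ?J * ?H u"
          by (subst integral_mult_left_zero) simp
        finally show ?thesis .
      qed
      then show "integrable lborel (\<lambda>u. LINT k|lborel. norm (case (u, k) of (u, k) \<Rightarrow> indicat_real ?J k *\<^sub>R ?H u))"
        using integrable_mult_right[OF H, of "measure lborel ?J"] by simp
      show "AE u in lborel. integrable lborel (\<lambda>k. case (u, k) of (u, k) \<Rightarrow> indicat_real ?J k *\<^sub>R ?H u)"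
        by (intro AE_I2) (auto intro!: integrable_mult_left integrable_real_indicator)
    qed measurable
    have "norm (?f u k) \<le> norm (indicat_real ?J k *\<^sub>R ?H u)" for u k
    proof (cases "u > 0 \<and> k \<in> ?J")
      case True
      then show ?thesis
        using order_trans[OF c(2)[of k u] abs_ge_self] by (simp only: indicator_simps scaleR_one real_norm_def greaterThan_iff simp_thms)
    next
      case False
      then have "?f u k = 0" by (auto simp: indicator_def)
      then show ?thesis by (simp only: norm_zero norm_ge_zero)
    qed
    then show "AE p in lborel \<Otimes>\<^sub>M lborel. norm (case_prod ?f p) \<le> norm (case p of (u, k) \<Rightarrow> indicat_real ?J k *\<^sub>R ?H u)"
      by (intro AE_I2) (auto split: prod.splits)
  qed measurable
  have "(LINT u|lborel. (LINT v|lborel. indicator {v. u + \<alpha> * v > 0 \<and> v \<in> wedge_side \<alpha>} v *\<^sub>R gexp (inverse (zvar l)) (\<i> * of_real x / zvar l) v) * gexp (inverse (wvar \<bar>\<alpha>\<bar> s l)) (\<i> * of_real (x * b) / wvar \<bar>\<alpha>\<bar> s l) u) =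
      (LINT u|lborel. LINT k|lborel. ?f u k)"
    by (simp only: wedge_inner integral_scaleR_right)
  also have "\<dots> = (LINT k|lborel. LINT u|lborel. ?f u k)"
    by (rule lborel_pair.Fubini_integral[symmetric, OF int])
  also have "\<dots> = (LINT k:?J|lborel. LINT u:{0<..}|lborel. of_real u * gexp (wquad \<bar>\<alpha>\<bar> s l k) (wlin \<bar>\<alpha>\<bar> s b (sgn \<alpha>) l x k) u)"
    unfolding set_lebesgue_integral_def
    by (subst integral_scaleR_right[symmetric])
      (intro Bochner_Integration.integral_cong refl, simp add: mult_ac scaleR_left_commute)
  finally show ?thesis .
qed

end

section \<open>Reduction of the multiplier integral to the wedge\<close>

text \<open>The modulation moves the centre to \<open>\<i> * x * z\<close>. For a chirp with
  \<open>z = 1 - \<i> * l * c\<close> its real part is \<open>l * c * x\<close>, the instantaneous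
  frequency at \<open>x\<close>.\<close>

lemma fourier_gexp_modulated:
  fixes x \<xi> :: real
  assumes "Re z > 0"
  shows "fourier (gexp z 0) \<xi> * exp (2 * pi * \<i> * x * \<xi>) =
    gint z 0 * exp (- (of_real pi * z * (of_real x)\<^sup>2)) * gauss z (\<i> * of_real x * z) \<xi>"
proof -
  have nz: "z \<noteq> 0" using assms by auto
  have "gexp (inverse z) 0 \<xi> * exp (2 * pi * \<i> * x * \<xi>) = gexp (inverse z) (\<i> * of_real x) \<xi>"
    unfolding gexp_def exp_add[symmetric] by (intro arg_cong[of _ _ exp]) simp
  moreover have "gauss z (\<i> * of_real x * z) \<xi> = exp (of_real pi * z * (of_real x)\<^sup>2) * gexp (inverse z) (\<i> * of_real x) \<xi>"
    using nz by (subst gauss_eq_gexp[OF nz]) (simp add: power_mult_distrib power2_eq_square mult_ac)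
  ultimately show ?thesis
    unfolding fourier_gexp[OF assms] by (simp add: exp_minus mult.assoc)
qed

text \<open>The imaginary centres that remain after the real shift produce such factors; a lower
  estimate may drop them.\<close>

lemma norm_exp_inverse_ge_1:
  assumes "Re w > 0"
  shows "norm (exp (of_real pi * (of_real y)\<^sup>2 / w)) \<ge> 1"
proof -
  have "Re (of_real pi * (of_real y)\<^sup>2 / w) = pi * y\<^sup>2 * Re (inverse w)"
    by (simp add: divide_inverse flip: of_real_power of_real_mult)
  also have "\<dots> \<ge> 0"
    using Re_inverse_pos[OF assms] by (intro mult_nonneg_nonneg) (auto simp del: inverse_complex.sel)
  finally show ?thesis
    by (simp only: norm_exp_eq_Re one_le_exp_iff)
qed

lemma gauss_imaginary_center:
  assumes "w \<noteq> 0"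
  shows "gauss w (\<i> * of_real y) u = exp (of_real pi * (of_real y)\<^sup>2 / w) * gexp (inverse w) (\<i> * of_real y / w) u"
  by (subst gauss_eq_gexp[OF assms]) (simp add: power_mult_distrib)

context
  fixes n :: nat and \<alpha> c :: "nat \<Rightarrow> real" and l x :: real and z :: "nat \<Rightarrow> complex"
  assumes n: "n \<ge> 2" and \<alpha>: "\<And>j. j \<in> {1..n} \<Longrightarrow> \<alpha> j \<noteq> 0" and cn: "c n = 1"
    and c1: "(\<Sum>j\<in>{1..n}. \<alpha> j * c j) = 0" and c2: "(\<Sum>j\<in>{1..n}. (\<alpha> j)\<^sup>2 * c j) = 0"
    and z: "\<And>j. z j = Complex 1 (- (l * c j))"
begin

text \<open>The variables with \<open>j < n\<close> enter only through the sum \<open>u\<close> of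
  the \<open>\<alpha> j * \<xi> j\<close>, so \<open>integral_sum_prod_gauss\<close> collapses them
  to one complex Gaussian variable, independent of \<open>v = \<xi> n\<close>. What remains is an
  integral over the plane of \<open>u\<close> and \<open>v\<close>.\<close>

lemma chirp_integral_wedge:
  defines "s \<equiv> \<Sum>j\<in>{1..<n}. (\<alpha> j)\<^sup>2" and "b \<equiv> \<Sum>j\<in>{1..<n}. \<alpha> j"
  shows "\<exists>K. norm K \<ge> exp (- (pi * n * x\<^sup>2)) / sqrt (norm (zvar l * wvar \<bar>\<alpha> n\<bar> s l)) \<and>
    (LINT \<xi> : {\<xi> \<in> space (\<Pi>\<^sub>M j\<in>{1..n}. lborel). (\<Sum>j\<in>{1..n}. \<xi> j * \<alpha> j) > 0 \<and> \<xi> n - l * x \<in> wedge_side (\<alpha> n)}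
              | (\<Pi>\<^sub>M j\<in>{1..n}. lborel).
           (\<Prod>j\<in>{1..n}. fourier (gexp (z j) 0) (\<xi> j) * exp (2 * pi * \<i> * x * \<xi> j))) =
    K * (LINT k:{0..1/\<bar>\<alpha> n\<bar>}|lborel. LINT u:{0<..}|lborel.
      of_real u * gexp (wquad \<bar>\<alpha> n\<bar> s l k) (wlin \<bar>\<alpha> n\<bar> s b (sgn (\<alpha> n)) l x k) u)"
proof -
  let ?J = "{1..<n}" and ?S = "wedge_side (\<alpha> n)"
  let ?w = "wvar \<bar>\<alpha> n\<bar> s l"
  let ?\<mu> = "\<lambda>j. \<i> * of_real x * z j"
  have ins: "{1..n} = insert n ?J" and J: "finite ?J" "?J \<noteq> {}" "n \<notin> ?J" using n by auto
  have \<alpha>n: "\<alpha> n \<noteq> 0" using \<alpha>[of n] n by auto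
  have Rez: "Re (z j) > 0" for j by (simp add: z)
  have zn: "z n = zvar l" by (simp add: z zvar_def cn)
  have s: "s > 0" unfolding s_def using J \<alpha> by (intro sum_pos) auto
  have w_eq: "(\<Sum>j\<in>?J. of_real (\<alpha> j) ^ 2 * z j) = ?w"
  proof (rule complex_eqI)
    show "Re (\<Sum>j\<in>?J. of_real (\<alpha> j) ^ 2 * z j) = Re ?w"
      by (simp add: z wvar_def s_def flip: of_real_power)
    \<comment> \<open>The second rate condition turns the imaginary part of the variance of
      \<open>u\<close> into \<open>(\<alpha> n)\<^sup>2 * l\<close>, opposite in sign to that of
      \<open>zvar l\<close>.\<close>
    have c2': "(\<Sum>j\<in>?J. (\<alpha> j)\<^sup>2 * c j) = - (\<alpha> n)\<^sup>2"
      using c2 unfolding ins sum.insert[OF J(1,3)] cn by simp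
    have "(\<Sum>j\<in>?J. (\<alpha> j)\<^sup>2 * (l * c j)) = l * (\<Sum>j\<in>?J. (\<alpha> j)\<^sup>2 * c j)"
      by (simp add: sum_distrib_left mult_ac)
    also note c2'
    finally show "Im (\<Sum>j\<in>?J. of_real (\<alpha> j) ^ 2 * z j) = Im ?w"
      by (simp add: z wvar_def sum_negf mult.commute flip: of_real_power)
  qed
  have \<mu>_eq: "(\<Sum>j\<in>?J. of_real (\<alpha> j) * ?\<mu> j) = \<i> * of_real (x * b) - of_real (l * \<alpha> n * x)"
  proof -
    \<comment> \<open>The first rate condition gives the centre of \<open>u\<close> the real part
      \<open>- (l * \<alpha> n * x)\<close>, which is \<open>- \<alpha> n\<close> times the real
      part \<open>l * x\<close> of the centre of \<open>v\<close>.\<close>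
    have c1': "(\<Sum>j\<in>?J. \<alpha> j * c j) = - \<alpha> n"
      using c1 unfolding ins sum.insert[OF J(1,3)] cn by simp
    have "(\<Sum>j\<in>?J. of_real (\<alpha> j) * z j) = Complex b (l * \<alpha> n)"
    proof (rule complex_eqI)
      have "(\<Sum>j\<in>?J. \<alpha> j * (l * c j)) = l * (\<Sum>j\<in>?J. \<alpha> j * c j)"
        by (simp add: sum_distrib_left mult_ac)
      also note c1'
      finally show "Im (\<Sum>j\<in>?J. of_real (\<alpha> j) * z j) = Im (Complex b (l * \<alpha> n))"
        by (simp add: z sum_negf)
    qed (simp add: z b_def)
    then have "(\<Sum>j\<in>?J. of_real (\<alpha> j) * ?\<mu> j) = \<i> * of_real x * Complex b (l * \<alpha> n)"
      by (simp add: sum_distrib_left[symmetric] mult_ac)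
    then show ?thesis by (simp add: complex_eq_iff)
  qed
  have wRe: "Re ?w > 0" using s by (simp add: wvar_def)
  obtain K where K: "norm K = sqrt ((\<Prod>j\<in>?J. norm (z j)) / norm ?w)"
    and Kint: "\<And>F. F \<in> borel_measurable borel \<Longrightarrow> (\<exists>B. \<forall>u. norm (F u) \<le> B) \<Longrightarrow>
      (LINT \<xi>|(\<Pi>\<^sub>M j\<in>?J. lborel). F (\<Sum>j\<in>?J. \<alpha> j * \<xi> j) * (\<Prod>j\<in>?J. gauss (z j) (?\<mu> j) (\<xi> j))) =
      K * (LINT u|lborel. F u * gauss ?w (\<i> * of_real (x * b) - of_real (l * \<alpha> n * x)) u)"
    using integral_sum_prod_gauss[of ?J \<alpha> z ?\<mu>] J \<alpha> Rez unfolding w_eq \<mu>_eq by force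
  define A where "A j = gint (z j) 0 * exp (- (of_real pi * z j * (of_real x)\<^sup>2))" for j
  have A: "norm (A j) = exp (- (pi * x\<^sup>2)) / sqrt (norm (z j))" for j
    unfolding A_def norm_mult norm_gint_0[OF Rez] by (simp add: z flip: of_real_power)
  let ?I = "\<lambda>\<xi>::nat \<Rightarrow> real. indicator {0<..} (\<Sum>j\<in>{1..n}. \<alpha> j * \<xi> j) * indicator ?S (\<xi> n - l * x) :: complex"
  let ?\<Phi> = "\<lambda>u. LINT v|lborel. indicator {0<..} (u + \<alpha> n * v) * indicator ?S (v - l * x) * gauss (z n) (?\<mu> n) v"
  let ?E = "{\<xi> \<in> space (\<Pi>\<^sub>M j\<in>{1..n}. lborel). (\<Sum>j\<in>{1..n}. \<xi> j * \<alpha> j) > 0 \<and> \<xi> n - l * x \<in> ?S}"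
  have "(LINT \<xi> : ?E | (\<Pi>\<^sub>M j\<in>{1..n}. lborel).
           (\<Prod>j\<in>{1..n}. fourier (gexp (z j) 0) (\<xi> j) * exp (2 * pi * \<i> * x * \<xi> j))) =
      (LINT \<xi>|(\<Pi>\<^sub>M j\<in>{1..n}. lborel). (\<Prod>j\<in>{1..n}. A j) * (?I \<xi> * (\<Prod>j\<in>{1..n}. gauss (z j) (?\<mu> j) (\<xi> j))))"
    unfolding set_lebesgue_integral_def
  proof (intro Bochner_Integration.integral_cong refl)
    fix \<xi> :: "nat \<Rightarrow> real" assume sp: "\<xi> \<in> space (\<Pi>\<^sub>M j\<in>{1..n}. lborel)"
    have "(\<Prod>j\<in>{1..n}. fourier (gexp (z j) 0) (\<xi> j) * exp (2 * pi * \<i> * x * \<xi> j)) =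
      (\<Prod>j\<in>{1..n}. A j) * (\<Prod>j\<in>{1..n}. gauss (z j) (?\<mu> j) (\<xi> j))"
      unfolding fourier_gexp_modulated[OF Rez] A_def by (simp only: prod.distrib)
    moreover have "indicat_real ?E \<xi> *\<^sub>R y = ?I \<xi> * y" for y :: complex
      using sp by (auto simp: indicator_def mult.commute)
    ultimately show "indicat_real ?E \<xi> *\<^sub>R (\<Prod>j\<in>{1..n}. fourier (gexp (z j) 0) (\<xi> j) * exp (2 * pi * \<i> * x * \<xi> j)) =
      (\<Prod>j\<in>{1..n}. A j) * (?I \<xi> * (\<Prod>j\<in>{1..n}. gauss (z j) (?\<mu> j) (\<xi> j)))"
      by (simp only: mult.left_commute)
  qed
  also have "\<dots> = (\<Prod>j\<in>{1..n}. A j) * (LINT \<xi>|(\<Pi>\<^sub>M j\<in>{1..n}. lborel). ?I \<xi> * (\<Prod>j\<in>{1..n}. gauss (z j) (?\<mu> j) (\<xi> j)))"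
    by (rule integral_mult_right_zero)
  also have "(LINT \<xi>|(\<Pi>\<^sub>M j\<in>{1..n}. lborel). ?I \<xi> * (\<Prod>j\<in>{1..n}. gauss (z j) (?\<mu> j) (\<xi> j))) =
      (LINT y|(\<Pi>\<^sub>M j\<in>?J. lborel). LINT v|lborel. ?I (y(n:=v)) * (\<Prod>j\<in>{1..n}. gauss (z j) (?\<mu> j) ((y(n:=v)) j)))"
  proof -
    have "integrable (\<Pi>\<^sub>M j\<in>{1..n}. lborel) (\<lambda>\<xi>. ?I \<xi> * (\<Prod>j\<in>{1..n}. gauss (z j) (?\<mu> j) (\<xi> j)))"
    proof (rule integrable_prod_gauss[OF _ Rez, where B=1])
      have mn: "(\<lambda>\<xi>. \<xi> n) \<in> borel_measurable (\<Pi>\<^sub>M j\<in>{1..n}. lborel)"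
        using measurable_component_singleton[of n "{1..n}" "\<lambda>_. lborel :: real measure"] n by simp
      have m1: "(\<lambda>\<xi>. \<Sum>j\<in>{1..n}. \<alpha> j * \<xi> j) \<in> borel_measurable (\<Pi>\<^sub>M j\<in>{1..n}. lborel)"
        by measurable
      have m2: "(\<lambda>\<xi>. \<xi> n - l * x) \<in> borel_measurable (\<Pi>\<^sub>M j\<in>{1..n}. lborel)"
        by (intro borel_measurable_diff mn borel_measurable_const)
      show "?I \<in> borel_measurable (\<Pi>\<^sub>M j\<in>{1..n}. lborel)"
        by (intro borel_measurable_times measurable_compose[OF m1] measurable_compose[OF m2] borel_measurable_indicator) auto
    qed (auto simp: indicator_def)
    then show ?thesis
      unfolding ins by (intro lborel_product.product_integral_insert J)
  qed
  also have "\<dots> = (LINT y|(\<Pi>\<^sub>M j\<in>?J. lborel). ?\<Phi> (\<Sum>j\<in>?J. \<alpha> j * y j) * (\<Prod>j\<in>?J. gauss (z j) (?\<mu> j) (y j)))"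
  proof (intro Bochner_Integration.integral_cong refl)
    fix y :: "nat \<Rightarrow> real"
    have *: "(\<Sum>j\<in>?J. \<alpha> j * (y(n:=v)) j) = (\<Sum>j\<in>?J. \<alpha> j * y j)"
      "(\<Prod>j\<in>?J. gauss (z j) (?\<mu> j) ((y(n:=v)) j)) = (\<Prod>j\<in>?J. gauss (z j) (?\<mu> j) (y j))" for v
      using J(3) by (intro sum.cong prod.cong refl, metis fun_upd_other)+
    show "(LINT v|lborel. ?I (y(n:=v)) * (\<Prod>j\<in>{1..n}. gauss (z j) (?\<mu> j) ((y(n:=v)) j))) =
        ?\<Phi> (\<Sum>j\<in>?J. \<alpha> j * y j) * (\<Prod>j\<in>?J. gauss (z j) (?\<mu> j) (y j))"
      unfolding ins sum.insert[OF J(1,3)] prod.insert[OF J(1,3)] *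
      by (subst integral_mult_left_zero[symmetric]) (simp add: mult_ac add.commute)
  qed
  also have "\<dots> = K * (LINT u|lborel. ?\<Phi> u * gauss ?w (\<i> * of_real (x * b) - of_real (l * \<alpha> n * x)) u)"
  proof (rule Kint)
    show "?\<Phi> \<in> borel_measurable borel" by measurable
    have "norm (?\<Phi> u) \<le> (LINT v|lborel. norm (gauss (z n) (?\<mu> n) v))" for u
    proof (rule Bochner_Integration.integral_norm_bound_integral)
      show i: "integrable lborel (\<lambda>v. norm (gauss (z n) (?\<mu> n) v))"
        using integrable_gauss[OF Rez] by (rule integrable_norm)
      show le: "norm (indicator {0<..} (u + \<alpha> n * v) * indicator ?S (v - l * x) * gauss (z n) (?\<mu> n) v) \<le> norm (gauss (z n) (?\<mu> n) v)" for v
        by (simp add: indicator_def)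
      show "integrable lborel (\<lambda>v. indicator {0<..} (u + \<alpha> n * v) * indicator ?S (v - l * x) * gauss (z n) (?\<mu> n) v)"
      proof (rule Bochner_Integration.integrable_bound[OF i])
        show "AE v in lborel. norm (indicator {0<..} (u + \<alpha> n * v) * indicator ?S (v - l * x) * gauss (z n) (?\<mu> n) v) \<le> norm (norm (gauss (z n) (?\<mu> n) v))"
          using le by (intro AE_I2) (simp only: real_norm_def abs_norm_cancel)
      qed measurable
    qed
    then show "\<exists>B. \<forall>u. norm (?\<Phi> u) \<le> B" by blast
  qed
  \<comment> \<open>Both variables are translated by the real parts of their centres. These
    translations leave \<open>u + \<alpha> n * v\<close> invariant, and the second one moves the
    cut-off from \<open>l * x\<close> to 0.\<close>
  also have "(LINT u|lborel. ?\<Phi> u * gauss ?w (\<i> * of_real (x * b) - of_real (l * \<alpha> n * x)) u) =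
      (LINT u|lborel. ?\<Phi> (- (l * \<alpha> n * x) + u) * gauss ?w (\<i> * of_real (x * b)) u)"
    using lborel_integral_real_affine[of 1 "\<lambda>u. ?\<Phi> u * gauss ?w (\<i> * of_real (x * b) - of_real (l * \<alpha> n * x)) u" "- (l * \<alpha> n * x)"]
    by (simp add: gauss_def algebra_simps)
  also have "\<dots> = (LINT u|lborel. (LINT v|lborel. indicator {v. u + \<alpha> n * v > 0 \<and> v \<in> ?S} v *\<^sub>R gauss (zvar l) (\<i> * of_real x) v) * gauss ?w (\<i> * of_real (x * b)) u)"
  proof -
    have "?\<Phi> (- (l * \<alpha> n * x) + u) = (LINT v|lborel. indicator {v. u + \<alpha> n * v > 0 \<and> v \<in> ?S} v *\<^sub>R gauss (zvar l) (\<i> * of_real x) v)" for u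
    proof -
      have "?\<Phi> (- (l * \<alpha> n * x) + u) = (LINT v|lborel. indicator {0<..} (- (l * \<alpha> n * x) + u + \<alpha> n * (l * x + v)) *
          indicator ?S (l * x + v - l * x) * gauss (z n) (?\<mu> n) (l * x + v))"
        using lborel_integral_real_affine[of 1 "\<lambda>v. indicator {0<..} (- (l * \<alpha> n * x) + u + \<alpha> n * v) *
          indicator ?S (v - l * x) * gauss (z n) (?\<mu> n) v" "l * x"] by simp
      also have "\<dots> = (LINT v|lborel. indicator {v. u + \<alpha> n * v > 0 \<and> v \<in> ?S} v *\<^sub>R gauss (zvar l) (\<i> * of_real x) v)"
      proof (intro Bochner_Integration.integral_cong refl)
        fix v :: real
        have "complex_of_real (l * x + v) - ?\<mu> n = of_real v - \<i> * of_real x"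
          by (simp add: zn zvar_def complex_eq_iff)
        then have "gauss (z n) (?\<mu> n) (l * x + v) = gauss (zvar l) (\<i> * of_real x) v"
          by (simp only: gauss_def zn)
        moreover have "- (l * \<alpha> n * x) + u + \<alpha> n * (l * x + v) = u + \<alpha> n * v" "l * x + v - l * x = v"
          by (simp_all add: algebra_simps)
        ultimately show "indicator {0<..} (- (l * \<alpha> n * x) + u + \<alpha> n * (l * x + v)) *
          indicator ?S (l * x + v - l * x) * gauss (z n) (?\<mu> n) (l * x + v) =
          indicator {v. u + \<alpha> n * v > 0 \<and> v \<in> ?S} v *\<^sub>R gauss (zvar l) (\<i> * of_real x) v"
          by (simp add: indicator_def)
      qed
      finally show ?thesis .
    qed
    then show ?thesis by simp
  qed
  also have "\<dots> = exp (of_real pi * (of_real x)\<^sup>2 / zvar l) * exp (of_real pi * (of_real (x * b))\<^sup>2 / ?w) *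
    (LINT u|lborel. (LINT v|lborel. indicator {v. u + \<alpha> n * v > 0 \<and> v \<in> ?S} v *\<^sub>R gexp (inverse (zvar l)) (\<i> * of_real x / zvar l) v) * 
       gexp (inverse ?w) (\<i> * of_real (x * b) / ?w) u)" (is "_ = ?e1 * ?e2 * _")
  proof -
    have nz: "zvar l \<noteq> 0" "?w \<noteq> 0" using s by (auto simp: zvar_def wvar_def complex_eq_iff)
    have "(LINT v|lborel. indicator {v. u + \<alpha> n * v > 0 \<and> v \<in> ?S} v *\<^sub>R gauss (zvar l) (\<i> * of_real x) v) =
      ?e1 * (LINT v|lborel. indicator {v. u + \<alpha> n * v > 0 \<and> v \<in> ?S} v *\<^sub>R gexp (inverse (zvar l)) (\<i> * of_real x / zvar l) v)" for u
      by (subst integral_mult_right_zero[symmetric]) (simp only: gauss_imaginary_center[OF nz(1)] mult_scaleR_right)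
    moreover have "gauss ?w (\<i> * of_real (x * b)) u = ?e2 * gexp (inverse ?w) (\<i> * of_real (x * b) / ?w) u" for u
      by (rule gauss_imaginary_center[OF nz(2)])
    ultimately show ?thesis
      by (subst integral_mult_right_zero[symmetric]) (simp only: mult_ac)
  qed
  also note wedge_integral_eq[OF \<alpha>n s]
  finally have eq: "(LINT \<xi> : ?E | (\<Pi>\<^sub>M j\<in>{1..n}. lborel).
           (\<Prod>j\<in>{1..n}. fourier (gexp (z j) 0) (\<xi> j) * exp (2 * pi * \<i> * x * \<xi> j))) =
    (\<Prod>j\<in>{1..n}. A j) * (K * (?e1 * ?e2 * (LINT k:{0..1/\<bar>\<alpha> n\<bar>}|lborel. LINT u:{0<..}|lborel.
      of_real u * gexp (wquad \<bar>\<alpha> n\<bar> s l k) (wlin \<bar>\<alpha> n\<bar> s b (sgn (\<alpha> n)) l x k) u)))" .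
  show ?thesis
  proof (intro exI[of _ "(\<Prod>j\<in>{1..n}. A j) * K * (?e1 * ?e2)"] conjI)
    \<comment> \<open>The moduli of the \<open>z j\<close> with \<open>j < n\<close> cancel between
      the Fourier constants and \<open>K\<close>; only the variances of the two surviving variables
      remain.\<close>
    have "norm (\<Prod>j\<in>{1..n}. A j) = exp (- (pi * x\<^sup>2)) ^ n / sqrt (\<Prod>j\<in>{1..n}. norm (z j))"
    proof -
      have "sqrt (\<Prod>j\<in>I. norm (z j)) = (\<Prod>j\<in>I. sqrt (norm (z j)))" if "finite I" for I
        using that by induction (auto simp: real_sqrt_mult)
      then show ?thesis
        by (simp add: prod_norm[symmetric] A prod_dividef)
    qed
    also have "exp (- (pi * x\<^sup>2)) ^ n = exp (- (pi * n * x\<^sup>2))"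
      by (simp add: exp_of_nat_mult[symmetric] mult_ac)
    also have "(\<Prod>j\<in>{1..n}. norm (z j)) = norm (zvar l) * (\<Prod>j\<in>?J. norm (z j))"
      unfolding ins prod.insert[OF J(1,3)] zn ..
    finally have "norm ((\<Prod>j\<in>{1..n}. A j) * K) = exp (- (pi * n * x\<^sup>2)) / sqrt (norm (zvar l) * (\<Prod>j\<in>?J. norm (z j))) *
        sqrt ((\<Prod>j\<in>?J. norm (z j)) / norm ?w)"
      by (simp add: norm_mult K)
    also have "\<dots> = exp (- (pi * n * x\<^sup>2)) / sqrt (norm (zvar l * ?w))"
    proof -
      have "(\<Prod>j\<in>?J. norm (z j)) > 0" by (intro prod_pos) (auto simp: z complex_eq_iff)
      moreover have "e / sqrt (a * P) * sqrt (P / d) = e / sqrt (a * d)" if "P > 0" for e a d P :: real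
        using that by (simp add: real_sqrt_mult real_sqrt_divide)
      ultimately show ?thesis
        unfolding norm_mult by blast
    qed
    finally have "norm ((\<Prod>j\<in>{1..n}. A j) * K) = exp (- (pi * n * x\<^sup>2)) / sqrt (norm (zvar l * ?w))" .
    moreover have "1 \<le> norm (?e1 * ?e2)"
      using mult_mono[OF norm_exp_inverse_ge_1[of "zvar l" x] norm_exp_inverse_ge_1[OF wRe, of "x * b"]]
      unfolding norm_mult by (simp add: zvar_def del: norm_exp_eq_Re)
    moreover have "r \<le> norm (P * Q)" if "norm P = r" "1 \<le> norm Q" for r :: real and P Q :: complex
      using mult_left_mono[OF that(2) norm_ge_zero[of P]] that(1) by (simp add: norm_mult)
    ultimately show "exp (- (pi * n * x\<^sup>2)) / sqrt (norm (zvar l * ?w)) \<le> norm ((\<Prod>j\<in>{1..n}. A j) * K * (?e1 * ?e2))"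
      by blast
  qed (subst eq, simp only: mult.assoc)
qed

end

section \<open>Cut-offs and norms\<close>

text \<open>The supremum offers only the cut-offs \<open>h y < m\<close>. By dominated convergence
  the integral without cut-off is also bounded by \<open>t\<close>, and the upper part is a
  difference of two such integrals, hence the factor 2.\<close>

lemma norm_upper_slab_integral_le:
  fixes g :: "'a \<Rightarrow> complex" and h :: "'a \<Rightarrow> real"
  assumes g: "integrable M g" and P[measurable]: "Measurable.pred M P" and h[measurable]: "h \<in> borel_measurable M"
    and t: "\<And>m. norm (LINT y:{y \<in> space M. P y \<and> h y < m}|M. g y) \<le> t"
  shows "norm (LINT y:{y \<in> space M. P y \<and> h y \<ge> m}|M. g y) \<le> 2 * t"
proof -
  let ?I = "\<lambda>A. LINT y:{y \<in> space M. A y}|M. g y"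
  note [measurable] = borel_measurable_integrable[OF g]
  have int: "integrable M (\<lambda>y. indicat_real {y \<in> space M. A y} y *\<^sub>R g y)" if [measurable]: "Measurable.pred M A" for A
    by (rule integrable_mult_indicator[OF _ g]) measurable
  have "(\<lambda>k. ?I (\<lambda>y. P y \<and> h y < real k)) \<longlonglongrightarrow> ?I P"
    unfolding set_lebesgue_integral_def
  proof (rule integral_dominated_convergence[where w="\<lambda>y. norm (g y)"])
    show "AE y in M. (\<lambda>k. indicat_real {y \<in> space M. P y \<and> h y < real k} y *\<^sub>R g y)
        \<longlonglongrightarrow> indicat_real {y \<in> space M. P y} y *\<^sub>R g y"
    proof (intro AE_I2 tendsto_eventually)
      fix y
      obtain k0 where "h y < real k0" using reals_Archimedean2 by blast
      then show "\<forall>\<^sub>F k in sequentially. indicat_real {y \<in> space M. P y \<and> h y < real k} y *\<^sub>R g y = indicat_real {y \<in> space M. P y} y *\<^sub>R g y"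
        by (intro eventually_sequentiallyI[of k0]) (auto simp: indicator_def)
    qed
    show "AE y in M. norm (indicat_real {y \<in> space M. P y \<and> h y < real k} y *\<^sub>R g y) \<le> norm (g y)" for k
      by (intro AE_I2) (auto simp: indicator_def)
  qed (use g in \<open>measurable, auto\<close>)
  then have "norm (?I P) \<le> t"
    by (rule Lim_norm_ubound[rotated]) (auto intro!: always_eventually t)
  moreover have "?I (\<lambda>y. P y \<and> h y \<ge> m) = ?I P - ?I (\<lambda>y. P y \<and> h y < m)"
  proof -
    have "?I (\<lambda>y. P y \<and> h y \<ge> m) =
        (LINT y|M. indicat_real {y \<in> space M. P y} y *\<^sub>R g y - indicat_real {y \<in> space M. P y \<and> h y < m} y *\<^sub>R g y)"
      unfolding set_lebesgue_integral_def
      by (intro Bochner_Integration.integral_cong refl) (auto simp: indicator_def)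
    also have "\<dots> = ?I P - ?I (\<lambda>y. P y \<and> h y < m)"
      unfolding set_lebesgue_integral_def by (intro Bochner_Integration.integral_diff int) measurable
    finally show ?thesis .
  qed
  ultimately show ?thesis
    using norm_triangle_ineq4[of "?I P" "?I (\<lambda>y. P y \<and> h y < m)"] t[of m] by simp
qed

text \<open>According to the sign of \<open>a\<close>, the side is the lower part of the cut or its
  complement; the factor 2 covers both cases.\<close>

lemma norm_wedge_integral_le_maximal_multiplier_op:
  fixes f :: "nat \<Rightarrow> real \<Rightarrow> complex" and x :: real and n :: nat
  defines "g \<equiv> \<lambda>\<xi>. \<Prod>j\<in>{1..n}. fourier (f j) (\<xi> j) * exp (2 * pi * \<i> * x * \<xi> j)"
  assumes g: "integrable (\<Pi>\<^sub>M j\<in>{1..n}. lborel) g" and n: "n \<ge> 1"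
  shows "ennreal (norm (LINT \<xi>:{\<xi> \<in> space (\<Pi>\<^sub>M j\<in>{1..n}. lborel). (\<Sum>j\<in>{1..n}. \<xi> j * \<alpha> j) > 0 \<and> \<xi> n - m \<in> wedge_side a}
        | (\<Pi>\<^sub>M j\<in>{1..n}. lborel). g \<xi>)) \<le> 2 * maximal_multiplier_op n \<alpha> f x" (is "ennreal (norm ?int) \<le> _")
proof (cases "maximal_multiplier_op n \<alpha> f x" rule: ennreal_cases)
  case (real t)
  let ?P = "\<Pi>\<^sub>M j\<in>{1..n}. (lborel :: real measure)"
  have mn: "(\<lambda>\<xi>. \<xi> n) \<in> borel_measurable ?P"
    using measurable_component_singleton[of n "{1..n}" "\<lambda>_. lborel :: real measure"] n by simp
  have pred: "Measurable.pred ?P (\<lambda>\<xi>. (\<Sum>j\<in>{1..n}. \<xi> j * \<alpha> j) > 0)"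
    by measurable
  have le: "norm (LINT \<xi>:{\<xi> \<in> space ?P. (\<Sum>j\<in>{1..n}. \<xi> j * \<alpha> j) > 0 \<and> \<xi> n < M} | ?P. g \<xi>) \<le> t" for M
  proof -
    have "ennreal (norm (LINT \<xi>:{\<xi> \<in> space ?P. (\<Sum>j\<in>{1..n}. \<xi> j * \<alpha> j) > 0 \<and> \<xi> n < M} | ?P. g \<xi>)) \<le> maximal_multiplier_op n \<alpha> f x"
      unfolding maximal_multiplier_op_def g_def by (rule SUP_upper2[OF UNIV_I order_refl])
    then show ?thesis using real by simp
  qed
  have "norm ?int \<le> 2 * t"
  proof (cases "a > 0")
    case True
    then show ?thesis
      using le[of m] real by (simp add: wedge_side_def)
  next
    case False
    then show ?thesis
      using norm_upper_slab_integral_le[OF g pred mn le, of m] by (simp add: wedge_side_def)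
  qed
  moreover have "2 * ennreal t = ennreal (2 * t)"
    using real(1) by (simp add: ennreal_mult)
  ultimately show ?thesis
    unfolding real(2) by (simp only: ennreal_leI)
qed (simp add: ennreal_mult_top)

section \<open>Lower and upper bounds for the norms\<close>

lemma ennreal_powr_ge:
  assumes "ennreal a \<le> y" "a \<ge> 0" "r > 0"
  shows "ennreal (a powr r) \<le> ennreal_powr y r"
proof (cases y rule: ennreal_cases)
  case (real t)
  then have "a \<le> t" using assms by simp
  then show ?thesis
    using assms real by (simp add: ennreal_powr_def powr_mono2 ennreal_leI)
qed (simp add: ennreal_powr_def)

text \<open>Chebyshev on a fixed interval: for finite \<open>p\<close> the constant is a power of
  its length, for exponents below 1 as well. It is uniform in \<open>R\<close> and \<open>g\<close>,
  so it can be fixed before the chirps are chosen.\<close>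

lemma Lp_norm_lower_bound:
  assumes p: "p > 0" and d: "d > 0"
  shows "\<exists>\<kappa>>0. \<forall>R g. 0 \<le> R \<longrightarrow> (\<forall>x\<in>{-d..d}. ennreal R \<le> g x) \<longrightarrow> ennreal (\<kappa> * R) \<le> Lp_norm p g"
proof (cases "p = \<infinity>")
  case True
  have "ennreal (1 * R) \<le> Lp_norm p g" if R: "\<forall>x\<in>{-d..d}. ennreal R \<le> g x" for R g
  proof (rule ccontr)
    assume "\<not> ennreal (1 * R) \<le> Lp_norm p g"
    then have less: "esssup lborel g < ennreal R" using True by (simp add: Lp_norm_def)
    have "AE x in lborel. g x \<le> esssup lborel g" by (rule esssup_AE)
    then have "AE x in lborel. x \<notin> {-d..d}"
      by eventually_elim (use less R in fastforce)
    then have "emeasure lborel {-d..d} = 0"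
      by (subst (asm) AE_iff_measurable[of "{-d..d}"]) auto
    then show False using d by simp
  qed
  then show ?thesis by (intro exI[of _ 1]) auto
next
  case False
  define r where "r = enn2real p"
  have r: "r > 0" using p False by (simp add: r_def enn2real_positive_iff top.not_eq_extremum)
  have "ennreal ((2 * d) powr (1 / r) * R) \<le> Lp_norm p g" if R: "0 \<le> R" "\<forall>x\<in>{-d..d}. ennreal R \<le> g x" for R g
  proof -
    have "ennreal (R powr r * (2 * d)) = (\<integral>\<^sup>+ x. ennreal (R powr r) * indicator {-d..d} x \<partial>lborel)"
      using d by (subst nn_integral_cmult_indicator) (auto simp: ennreal_mult)
    also have "\<dots> \<le> (\<integral>\<^sup>+ x. ennreal_powr (g x) r \<partial>lborel)"
      using R r by (intro nn_integral_mono) (auto simp: indicator_def intro!: ennreal_powr_ge)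
    finally have "ennreal ((R powr r * (2 * d)) powr (1 / r)) \<le> ennreal_powr (\<integral>\<^sup>+ x. ennreal_powr (g x) r \<partial>lborel) (1 / r)"
      using d r by (intro ennreal_powr_ge) auto
    also have "\<dots> = Lp_norm p g" using False by (simp add: Lp_norm_def r_def)
    also have "(R powr r * (2 * d)) powr (1 / r) = (2 * d) powr (1 / r) * R"
      using R d r by (simp add: powr_mult powr_powr mult.commute)
    finally show ?thesis .
  qed
  moreover have "(2 * d) powr (1 / r) > 0" using d by simp
  ultimately show ?thesis by blast
qed

lemma Lp_norm_gaussian_finite:
  assumes p: "p > 0"
  shows "Lp_norm p (\<lambda>x. ennreal (exp (- (pi * x\<^sup>2)))) < \<infinity>"
proof (cases "p = \<infinity>")
  case True
  have "esssup lborel (\<lambda>x::real. ennreal (exp (- (pi * x\<^sup>2)))) \<le> 1"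
    by (rule esssup_I) (auto simp: ennreal_le_1)
  then show ?thesis using True by (auto simp: Lp_norm_def intro: le_less_trans)
next
  case False
  define r where "r = enn2real p"
  have r: "r > 0" using p False by (simp add: r_def enn2real_positive_iff top.not_eq_extremum)
  have "(\<integral>\<^sup>+ x. ennreal_powr (ennreal (exp (- (pi * x\<^sup>2)))) r \<partial>lborel) = (\<integral>\<^sup>+ x. ennreal (exp (- (pi * r * x\<^sup>2))) \<partial>lborel)"
    by (intro nn_integral_cong) (simp add: ennreal_powr_def exp_powr_real mult_ac)
  also have "\<dots> = ennreal (LINT x|lborel. exp (- (pi * r * x\<^sup>2)))"
    using r by (intro nn_integral_eq_integral integrable_exp_neg_square) auto
  finally show ?thesis
    using False by (simp add: Lp_norm_def r_def[symmetric] ennreal_powr_def)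
qed

section \<open>Choice of the rates and contradiction\<close>

lemma ex_chirp_rates:
  fixes \<alpha> :: "nat \<Rightarrow> real"
  assumes n: "n \<ge> 3" and nz: "\<alpha> 1 \<noteq> 0" "\<alpha> 2 \<noteq> 0" and ne: "\<alpha> 1 \<noteq> \<alpha> 2"
  shows "\<exists>c. c n = 1 \<and> (\<Sum>j\<in>{1..n}. \<alpha> j * c j) = 0 \<and> (\<Sum>j\<in>{1..n}. (\<alpha> j)\<^sup>2 * c j) = 0"
proof -
  \<comment> \<open>Cramer's rule for the two equations in \<open>c 1\<close> and
    \<open>c 2\<close>, with \<open>c n = 1\<close> on the other side and all further rates 0. Since
    \<open>n \<ge> 3\<close>, the indices 1, 2 and \<open>n\<close> are distinct; the determinant is
    \<open>\<alpha> 1 * \<alpha> 2 * (\<alpha> 2 - \<alpha> 1)\<close>.\<close>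
  define c :: "nat \<Rightarrow> real" where "c j = (if j = n then 1
    else if j = 1 then \<alpha> n * (\<alpha> 2 - \<alpha> n) / (\<alpha> 1 * (\<alpha> 1 - \<alpha> 2))
    else if j = 2 then \<alpha> n * (\<alpha> n - \<alpha> 1) / (\<alpha> 2 * (\<alpha> 1 - \<alpha> 2)) else 0)" for j
  have sum: "(\<Sum>j\<in>{1..n}. h j * c j) = h 1 * c 1 + h 2 * c 2 + h n * c n" for h :: "nat \<Rightarrow> real"
  proof -
    have "(\<Sum>j\<in>{1..n}. h j * c j) = (\<Sum>j\<in>{1, 2, n}. h j * c j)"
      using n by (intro sum.mono_neutral_right) (auto simp: c_def)
    then show ?thesis using n by simp
  qed
  have c: "c n = 1" "c 1 = \<alpha> n * (\<alpha> 2 - \<alpha> n) / (\<alpha> 1 * (\<alpha> 1 - \<alpha> 2))" "c 2 = \<alpha> n * (\<alpha> n - \<alpha> 1) / (\<alpha> 2 * (\<alpha> 1 - \<alpha> 2))"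
    using n by (auto simp: c_def)
  have ne': "\<alpha> 1 - \<alpha> 2 \<noteq> 0" using ne by simp
  have "\<alpha> 1 * c 1 + \<alpha> 2 * c 2 + \<alpha> n * c n = 0" "(\<alpha> 1)\<^sup>2 * c 1 + (\<alpha> 2)\<^sup>2 * c 2 + (\<alpha> n)\<^sup>2 * c n = 0"
    unfolding c using nz ne' by (simp_all add: divide_simps power2_eq_square) (simp_all add: algebra_simps)
  then show ?thesis using c(1) by (intro exI[of _ c]) (simp only: sum)
qed

lemma integrable_chirp_product:
  fixes x :: real and n :: nat
  assumes "\<And>j. Re (z j) > 0"
  shows "integrable (\<Pi>\<^sub>M j\<in>{1..n}. lborel)
    (\<lambda>\<xi>. \<Prod>j\<in>{1..n}. fourier (gexp (z j) 0) (\<xi> j) * exp (2 * pi * \<i> * x * \<xi> j))"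
proof -
  have "integrable (\<Pi>\<^sub>M j\<in>{1..n}. lborel) (\<lambda>\<xi>. \<Prod>j\<in>{1..n}.
      gint (z j) 0 * exp (- (of_real pi * z j * (of_real x)\<^sup>2)) * gauss (z j) (\<i> * of_real x * z j) (\<xi> j))"
    by (intro lborel_product.product_integrable_prod integrable_mult_right integrable_gauss assms) auto
  then show ?thesis
    unfolding fourier_gexp_modulated[OF assms] .
qed

lemma maximal_multiplier_op_unbounded:
  fixes n :: nat and \<alpha> :: "nat \<Rightarrow> real"
  assumes n: "n \<ge> 3" and \<alpha>: "\<And>j. j \<in> {1..n} \<Longrightarrow> \<alpha> j \<noteq> 0" and ne: "\<alpha> 1 \<noteq> \<alpha> 2"
  shows "\<exists>d>0. \<forall>R\<ge>0. \<exists>z. (\<forall>j. Re (z j) = 1) \<and>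
    (\<forall>x\<in>{-d..d}. ennreal R \<le> maximal_multiplier_op n \<alpha> (\<lambda>j. gexp (z j) 0) x)"
proof -
  obtain c where c: "c n = 1" "(\<Sum>j\<in>{1..n}. \<alpha> j * c j) = 0" "(\<Sum>j\<in>{1..n}. (\<alpha> j)\<^sup>2 * c j) = 0"
    using ex_chirp_rates[OF n _ _ ne] \<alpha>[of 1] \<alpha>[of 2] n by auto
  define s where "s = (\<Sum>j\<in>{1..<n}. (\<alpha> j)\<^sup>2)"
  define b where "b = (\<Sum>j\<in>{1..<n}. \<alpha> j)"
  have \<alpha>n: "\<alpha> n \<noteq> 0" using \<alpha>[of n] n by auto
  have s: "s > 0" unfolding s_def using n \<alpha> by (intro sum_pos) auto
  have "\<bar>\<alpha> n\<bar> > 0" "\<bar>sgn (\<alpha> n)\<bar> = 1" using \<alpha>n by (auto simp: sgn_if)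
  from wedge_integral_unbounded[OF this(1) s this(2), of b]
  obtain d where d: "d > 0" and unb: "\<And>R. \<exists>l>0. \<forall>x. \<bar>x\<bar> \<le> d \<longrightarrow> \<bar>x\<bar> \<le> 1 \<and>
    R * sqrt (norm (zvar l * wvar \<bar>\<alpha> n\<bar> s l)) \<le>
      norm (LINT k:{0..1/\<bar>\<alpha> n\<bar>}|lborel. LINT u:{0<..}|lborel.
        of_real u * gexp (wquad \<bar>\<alpha> n\<bar> s l k) (wlin \<bar>\<alpha> n\<bar> s b (sgn (\<alpha> n)) l x k) u)"
    by blast
  show ?thesis
  proof (intro exI[of _ d] conjI allI impI d)
    fix R :: real assume R: "R \<ge> 0"
    \<comment> \<open>The factor 2 pays for the passage from one side of the cut to the supremum,
      and \<open>exp (pi * n)\<close> for the Gaussian factor in the bound of \<open>K\<close>,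
      where \<open>\<bar>x\<bar> \<le> 1\<close>.\<close>
    obtain l where l: "\<And>x. \<bar>x\<bar> \<le> d \<Longrightarrow> \<bar>x\<bar> \<le> 1" "\<And>x. \<bar>x\<bar> \<le> d \<Longrightarrow>
      2 * exp (pi * n) * R * sqrt (norm (zvar l * wvar \<bar>\<alpha> n\<bar> s l)) \<le>
      norm (LINT k:{0..1/\<bar>\<alpha> n\<bar>}|lborel. LINT u:{0<..}|lborel.
        of_real u * gexp (wquad \<bar>\<alpha> n\<bar> s l k) (wlin \<bar>\<alpha> n\<bar> s b (sgn (\<alpha> n)) l x k) u)"
      using unb[of "2 * exp (pi * n) * R"] by blast
    define z where "z j = Complex 1 (- (l * c j))" for j
    have "ennreal R \<le> maximal_multiplier_op n \<alpha> (\<lambda>j. gexp (z j) 0) x" if x: "x \<in> {-d..d}" for x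
    proof -
      let ?N = "sqrt (norm (zvar l * wvar \<bar>\<alpha> n\<bar> s l))"
      let ?W = "LINT k:{0..1/\<bar>\<alpha> n\<bar>}|lborel. LINT u:{0<..}|lborel.
        of_real u * gexp (wquad \<bar>\<alpha> n\<bar> s l k) (wlin \<bar>\<alpha> n\<bar> s b (sgn (\<alpha> n)) l x k) u"
      let ?int = "LINT \<xi> : {\<xi> \<in> space (\<Pi>\<^sub>M j\<in>{1..n}. lborel). (\<Sum>j\<in>{1..n}. \<xi> j * \<alpha> j) > 0 \<and> \<xi> n - l * x \<in> wedge_side (\<alpha> n)}
              | (\<Pi>\<^sub>M j\<in>{1..n}. lborel).
           (\<Prod>j\<in>{1..n}. fourier (gexp (z j) 0) (\<xi> j) * exp (2 * pi * \<i> * x * \<xi> j))"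
      have x': "\<bar>x\<bar> \<le> d" using x by auto
      have "n \<ge> 2" using n by simp
      from chirp_integral_wedge[OF this \<alpha> c z_def, of x, folded s_def b_def]
      obtain K where K: "norm K \<ge> exp (- (pi * n * x\<^sup>2)) / ?N" "?int = K * ?W"
        by blast
      have "zvar l \<noteq> 0" "wvar \<bar>\<alpha> n\<bar> s l \<noteq> 0"
        using s by (auto simp: zvar_def wvar_def complex_eq_iff)
      then have N: "?N > 0" by simp
      have "2 * R = exp (- (pi * n)) * (2 * exp (pi * n) * R)"
        by (simp add: exp_minus)
      also have "\<dots> \<le> exp (- (pi * n * x\<^sup>2)) * (2 * exp (pi * n) * R)"
        using power_mono[OF l(1)[OF x'], of 2] R by (intro mult_right_mono) (auto simp: mult_left_le)
      also have "\<dots> = exp (- (pi * n * x\<^sup>2)) / ?N * (2 * exp (pi * n) * R * ?N)"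
        using N by simp
      also have "\<dots> \<le> norm K * norm ?W"
        using K(1) l(2)[OF x'] R by (intro mult_mono) auto
      also have "\<dots> = norm ?int" by (simp only: K(2) norm_mult)
      finally have "ennreal (2 * R) \<le> ennreal (norm ?int)" by (rule ennreal_leI)
      also have "\<dots> \<le> 2 * maximal_multiplier_op n \<alpha> (\<lambda>j. gexp (z j) 0) x"
        using n by (intro norm_wedge_integral_le_maximal_multiplier_op integrable_chirp_product) (auto simp: z_def)
      also have "ennreal (2 * R) = 2 * ennreal R" using R by (simp add: ennreal_mult)
      finally show ?thesis by (subst (asm) ennreal_mult_le_mult_iff) auto
    qed
    then show "\<exists>z. (\<forall>j. Re (z j) = 1) \<and>
      (\<forall>x\<in>{-d..d}. ennreal R \<le> maximal_multiplier_op n \<alpha> (\<lambda>j. gexp (z j) 0) x)"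
      by (intro exI[of _ z]) (auto simp: z_def)
  qed
qed

theorem corollary1:
  fixes n :: nat and q :: "nat \<Rightarrow> rat" and \<alpha> :: "nat \<Rightarrow> real"
  assumes "n \<ge> 3"
    and "inj_on q {1..n}"
    and "\<And>j. j \<in> {1..n} \<Longrightarrow> q j \<noteq> 0"
    and "\<And>j. j \<in> {1..n} \<Longrightarrow> \<alpha> j = inverse (of_rat (q j))"
  shows "satisfies_no_Lp_estimates n (maximal_multiplier_op n \<alpha>)"
  unfolding satisfies_no_Lp_estimates_def
proof (rule notI, elim exE conjE)
  fix p :: "nat \<Rightarrow> ennreal" and C :: ennreal
  assume p: "\<forall>j\<in>{1..n}. 1 \<le> p j" and C: "C < \<infinity>"
    and est: "\<forall>f. (\<forall>j\<in>{1..n}. schwartz (f j)) \<longrightarrow>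
      Lp_norm (inverse (\<Sum>j\<in>{1..n}. inverse (p j))) (maximal_multiplier_op n \<alpha> f)
        \<le> C * (\<Prod>j\<in>{1..n}. Lp_norm (p j) (\<lambda>x. ennreal (norm (f j x))))"
  have nz: "\<alpha> j \<noteq> 0" if "j \<in> {1..n}" for j
    using assms(3,4)[OF that] by simp
  have "q 1 \<noteq> q 2"
    using assms(1) inj_onD[OF assms(2), of 1 2] by auto
  then have "\<alpha> 1 \<noteq> \<alpha> 2"
    using assms(4)[of 1] assms(4)[of 2] assms(1) by simp
  from maximal_multiplier_op_unbounded[OF assms(1) nz this]
  obtain d where d: "d > 0" and large: "\<And>R. R \<ge> 0 \<Longrightarrow> \<exists>z. (\<forall>j. Re (z j) = 1) \<and>
    (\<forall>x\<in>{-d..d}. ennreal R \<le> maximal_multiplier_op n \<alpha> (\<lambda>j. gexp (z j) 0) x)"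
    by blast
  let ?P = "inverse (\<Sum>j\<in>{1..n}. inverse (p j))"
  \<comment> \<open>The target exponent is positive because the sum of the reciprocals is finite;
    only \<open>inverse top\<close> is 0 in \<open>ennreal\<close>.\<close>
  have "(\<Sum>j\<in>{1..n}. inverse (p j)) < top"
  proof (subst ennreal_sum_less_top, safe)
    fix j assume "j \<in> {1..n}"
    then have "p j \<noteq> 0" using p by force
    then show "inverse (p j) < top" by (simp add: top.not_eq_extremum[symmetric] ennreal_inverse_eq_top_iff)
  qed
  then have P: "?P > 0"
    by (auto simp: zero_less_iff_neq_zero ennreal_inverse_eq_0_iff)
  define B where "B = C * (\<Prod>j\<in>{1..n}. Lp_norm (p j) (\<lambda>x. ennreal (exp (- (pi * x\<^sup>2)))))"
  have "(\<Prod>j\<in>J. Lp_norm (p j) (\<lambda>x. ennreal (exp (- (pi * x\<^sup>2))))) < top" if "J \<subseteq> {1..n}" for J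
    using finite_subset[OF that finite_atLeastAtMost] that
  proof induction
    case (insert j J)
    then have "p j > 0" using p by (metis insert_subset less_le_trans zero_less_one)
    then show ?case
      using insert Lp_norm_gaussian_finite[of "p j"] by (simp add: ennreal_mult_less_top)
  qed simp
  from this[OF order_refl]
  have "(\<Prod>j\<in>{1..n}. Lp_norm (p j) (\<lambda>x. ennreal (exp (- (pi * x\<^sup>2))))) < top" .
  with C have B: "B < top" by (simp add: B_def ennreal_mult_less_top)
  obtain \<kappa> where \<kappa>: "\<kappa> > 0" "\<And>R g. 0 \<le> R \<Longrightarrow> (\<forall>x\<in>{-d..d}. ennreal R \<le> g x) \<Longrightarrow> ennreal (\<kappa> * R) \<le> Lp_norm ?P g"
    using Lp_norm_lower_bound[OF P d] by blast
  \<comment> \<open>The summand 1 makes \<open>\<kappa> * R\<close> exceed \<open>B\<close>, the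
    right-hand side of the estimate, which is the same for all chirps since
    \<open>Re (z j) = 1\<close>.\<close>
  define R where "R = (enn2real B + 1) / \<kappa>"
  have R: "R \<ge> 0" using \<kappa>(1) by (simp add: R_def)
  obtain z where z: "\<And>j. Re (z j) = 1"
    "\<forall>x\<in>{-d..d}. ennreal R \<le> maximal_multiplier_op n \<alpha> (\<lambda>j. gexp (z j) 0) x"
    using large[OF R] by blast
  have "ennreal (\<kappa> * R) \<le> Lp_norm ?P (maximal_multiplier_op n \<alpha> (\<lambda>j. gexp (z j) 0))"
    by (rule \<kappa>(2)[OF R z(2)])
  also have "\<dots> \<le> C * (\<Prod>j\<in>{1..n}. Lp_norm (p j) (\<lambda>x. ennreal (norm (gexp (z j) 0 x))))"
    using z(1) by (intro est[rule_format] schwartz_gexp) simp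
  also have "\<dots> = B"
    by (simp add: B_def norm_gexp z(1))
  also have "\<dots> = ennreal (enn2real B)"
    using B by simp
  finally have "\<kappa> * R \<le> enn2real B" by simp
  then show False using \<kappa>(1) by (simp add: R_def)
qed

end
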